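(* There is a polynomial-time $O(\sqrt{m})$-approximation algorithm for the Minimum $p$-Union problem, where $m$ is the number of hyperedges of the input hypergraph. That is, there is a polynomial-time algorithm which, given a hypergraph $H=(V,E)$ with $|E|=m$ and an integer $p\le m$, outputs a set $E'\subseteq E$ with $|E'|=p$ such that $|\bigcup_{e\in E'} e|\le O(\sqrt{m})\cdot \min\{|\bigcup_{e\in E''} e| : E''\subseteq E,\ |E''|=p\}$.
   Context: A hypergraph $H=(V,E)$ consists of a finite vertex set $V$ and a collection $E$ of subsets of $V$ (hyperedges). The Minimum $p$-Union problem: given a hypergraph $H=(V,E)$ and an integer $p$, find $E'\subseteq E$ with $|E'|=p$ minimizing $|\bigcup_{e\in E'}e|$. *)

theory Defs
  imports Complex_Main "HOL-Library.Log_Nat" "HOL-Computational_Algebra.Polynomial"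
begin

text \<open>
  The machine model is a random access machine in the style of Cook and Reckhow: memory cells hold
  natural numbers of arbitrary size, the arithmetic operations are addition and truncated
  subtraction, addresses may be computed, and time is charged logarithmically, that is, by the bit
  lengths of all numbers handled. Polynomial time on this machine is polynomial time on Turing
  machines. Programs are structured (sequence, conditional, while loop), and memory consists of
  named, unbounded, zero-initialised arrays; as a program mentions only finitely many names, these
  can be interleaved in a single memory.
\<close>

type_synonym vname = string
type_synonym state = "vname \<Rightarrow> nat \<Rightarrow> nat"

datatype aexp = Const nat | Read vname aexp | Add aexp aexp | Sub aexp aexp
datatype bexp = Less aexp aexp | BNot bexp | BAnd bexp bexp
datatype com =
    Skip
  | Write vname aexp aexp   \<comment> \<open>\<open>Write x i a\<close> is the array update \<open>x[i] := a\<close>\<close>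
  | Seq com com
  | Cond bexp com com
  | While bexp com

definition len :: "nat \<Rightarrow> nat" where
  "len n = Suc (floorlog 2 n)"

fun aval :: "aexp \<Rightarrow> state \<Rightarrow> nat" where
  "aval (Const n) s = n"
| "aval (Read x i) s = s x (aval i s)"
| "aval (Add a b) s = aval a s + aval b s"
| "aval (Sub a b) s = aval a s - aval b s"

fun bval :: "bexp \<Rightarrow> state \<Rightarrow> bool" where
  "bval (Less a b) s \<longleftrightarrow> aval a s < aval b s"
| "bval (BNot b) s \<longleftrightarrow> \<not> bval b s"
| "bval (BAnd a b) s \<longleftrightarrow> bval a s \<and> bval b s"

text \<open>
  Every subexpression is charged the length of its value; this covers the operands of arithmetic,
  the contents read, and the addresses.
\<close>

fun acost :: "aexp \<Rightarrow> state \<Rightarrow> nat" where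
  "acost (Const n) s = len n"
| "acost (Read x i) s = acost i s + len (s x (aval i s))"
| "acost (Add a b) s = acost a s + acost b s + len (aval a s + aval b s)"
| "acost (Sub a b) s = acost a s + acost b s + len (aval a s - aval b s)"

fun bcost :: "bexp \<Rightarrow> state \<Rightarrow> nat" where
  "bcost (Less a b) s = acost a s + acost b s + 1"
| "bcost (BNot b) s = bcost b s + 1"
| "bcost (BAnd a b) s = bcost a s + bcost b s + 1"

text \<open>
  \<open>exec c s t s'\<close>: started in state \<open>s\<close>, program \<open>c\<close> halts in state \<open>s'\<close> after time \<open>t\<close>.
\<close>

inductive exec :: "com \<Rightarrow> state \<Rightarrow> nat \<Rightarrow> state \<Rightarrow> bool" where
  Skip: "exec Skip s 1 s"
| Write: "exec (Write x i a) s (acost i s + acost a s + 1)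
            (s(x := (s x)(aval i s := aval a s)))"
| Seq: "exec c1 s1 t1 s2 \<Longrightarrow> exec c2 s2 t2 s3 \<Longrightarrow> exec (Seq c1 c2) s1 (t1 + t2) s3"
| CondTrue: "bval b s \<Longrightarrow> exec c1 s t s' \<Longrightarrow> exec (Cond b c1 c2) s (bcost b s + t + 1) s'"
| CondFalse: "\<not> bval b s \<Longrightarrow> exec c2 s t s' \<Longrightarrow> exec (Cond b c1 c2) s (bcost b s + t + 1) s'"
| WhileFalse: "\<not> bval b s \<Longrightarrow> exec (While b c) s (bcost b s + 1) s"
| WhileTrue: "bval b s1 \<Longrightarrow> exec c s1 t1 s2 \<Longrightarrow> exec (While b c) s2 t2 s3 \<Longrightarrow>
    exec (While b c) s1 (bcost b s1 + t1 + t2 + 1) s3"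

inductive_cases SkipE: "exec Skip s t s'"
inductive_cases WriteE: "exec (Write x i a) s t s'"
inductive_cases SeqE: "exec (Seq c1 c2) s t s'"
inductive_cases CondE: "exec (Cond b c1 c2) s t s'"
inductive_cases WhileE: "exec (While b c) s t s'"

lemma exec_deterministic:
  "exec c s t s' \<Longrightarrow> exec c s u s'' \<Longrightarrow> t = u \<and> s' = s''"
proof (induction arbitrary: u s'' rule: exec.induct)
  case Skip
  then show ?case by (auto elim: SkipE)
next
  case Write
  then show ?case by (auto elim: WriteE)
next
  case (Seq c1 s1 t1 s2 c2 t2 s3)
  from Seq.prems obtain u1 u2 r where "u = u1 + u2" "exec c1 s1 u1 r" "exec c2 r u2 s''"
    by (auto elim: SeqE)
  with Seq.IH show ?case by metis
next
  case (CondTrue b s c1 t s' c2)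
  from CondTrue.prems CondTrue.hyps(1) obtain v where
    "u = bcost b s + v + 1" "exec c1 s v s''"
    by (auto elim: CondE)
  with CondTrue.IH show ?case by metis
next
  case (CondFalse b s c2 t s' c1)
  from CondFalse.prems CondFalse.hyps(1) obtain v where
    "u = bcost b s + v + 1" "exec c2 s v s''"
    by (auto elim: CondE)
  with CondFalse.IH show ?case by metis
next
  case (WhileFalse b s c)
  from WhileFalse.prems WhileFalse.hyps show ?case by (auto elim: WhileE)
next
  case (WhileTrue b s1 c t1 s2 t2 s3)
  from WhileTrue.prems WhileTrue.hyps(1) obtain u1 u2 r where
    "u = bcost b s1 + u1 + u2 + 1" "exec c s1 u1 r" "exec (While b c) r u2 s''"
    by (auto elim: WhileE)
  with WhileTrue.IH show ?case by metis
qed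

text \<open>
  Input and output are lists of numbers, stored in the arrays \<open>in\<close> and \<open>out\<close>: the length in cell 0,
  the entries from cell 1 on.
\<close>

definition load :: "nat list \<Rightarrow> state" where
  "load ws = (\<lambda>x i. if x = ''in'' \<and> i \<le> length ws then (length ws # ws) ! i else 0)"

definition result :: "state \<Rightarrow> nat list" where
  "result s = map (s ''out'') [1..<Suc (s ''out'' 0)]"

definition computes :: "com \<Rightarrow> nat list \<Rightarrow> nat \<Rightarrow> nat list \<Rightarrow> bool" where
  "computes c ws t ws' \<longleftrightarrow> (\<exists>s. exec c (load ws) t s \<and> result s = ws')"

definition bit_size :: "nat list \<Rightarrow> nat" where
  "bit_size ws = sum_list (map len ws)"

definition hypergraph :: "nat set \<Rightarrow> nat set set \<Rightarrow> bool" where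
  "hypergraph V E \<longleftrightarrow> finite V \<and> E \<subseteq> Pow V"

text \<open>
  A finite set is encoded by any duplicate-free listing preceded by its length. Nested lists are
  self-delimiting, so a list of numbers encodes at most one set of hyperedges.
\<close>

definition encodes_set :: "nat set \<Rightarrow> nat list \<Rightarrow> bool" where
  "encodes_set A ws \<longleftrightarrow> (\<exists>xs. distinct xs \<and> set xs = A \<and> ws = length xs # xs)"

definition encodes_edges :: "nat set set \<Rightarrow> nat list \<Rightarrow> bool" where
  "encodes_edges E ws \<longleftrightarrow>
     (\<exists>As wss. distinct As \<and> set As = E \<and> list_all2 encodes_set As wss \<and>
        ws = length As # concat wss)"

definition encodes_instance :: "nat set \<Rightarrow> nat set set \<Rightarrow> nat \<Rightarrow> nat list \<Rightarrow> bool" where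
  "encodes_instance V E p ws \<longleftrightarrow>
     (\<exists>us vs. encodes_set V us \<and> encodes_edges E vs \<and> ws = p # us @ vs)"

definition min_union :: "nat set set \<Rightarrow> nat \<Rightarrow> nat" where
  "min_union E p = Min {card (\<Union>E') | E'. E' \<subseteq> E \<and> card E' = p}"

end

(*
  Let s be about sqrt (2 m). In each of N rounds (N at least the number of vertices), every nonempty
  edge adds a unit to its currently least loaded vertex. The algorithm takes p - s edges in the order
  of decreasing minimal load of their vertices, and then fills up to p edges by increasing size.
  Let an optimal solution have union of size k. Those of its edges which at the end have a vertex of
  load less than A have always put their units on one of the k vertices while it had load less than A,
  so there are at most k A / N of them, that is, at most s for A = floor (s N / k). Hence all edges of
  the first kind have only vertices of load at least A, and as the total load is at most N m there
  are only O(m k / s) = O(s k) such vertices. The other edges are at most s in number, and of size at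
  most k each.
*)

theory Submission
  imports Defs
begin

text \<open>The algorithm knows neither \<open>k\<close> nor \<open>A\<close>. Taking edges by
  decreasing minimal load serves every threshold at once, and filling up by increasing size serves
  every \<open>k\<close>, so nothing has to be guessed. The loads can be read as an approximate
  solution of the linear program that splits each edge fractionally among its vertices so as to
  balance the loads; a set of few vertices containing many edges forces high load there. The choice
  of \<open>s\<close> balances the two costs, of order \<open>m k / s\<close> for the edges of large
  load and \<open>s k\<close> for the remaining ones. Having at least \<open>k\<close> rounds
  ensures that rounding \<open>s N / k\<close> down to an integer loses only a factor two. The
  machine is the other obstacle: it has no multiplication, it charges bit lengths, and vertex names
  may be exponential in the length of the input. Time is therefore split into a number of steps,
  governed by loop bounds that do not involve the names, and a price per step, which stays small
  because stored values grow only additively.\<close>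

section \<open>Counting steps instead of bit operations\<close>

inductive steps :: "com \<Rightarrow> state \<Rightarrow> nat \<Rightarrow> state \<Rightarrow> bool" where
  "steps Skip s 1 s"
| "steps (Write x i a) s 1 (s(x := (s x)(aval i s := aval a s)))"
| "steps c1 s1 n1 s2 \<Longrightarrow> steps c2 s2 n2 s3 \<Longrightarrow> steps (Seq c1 c2) s1 (n1 + n2) s3"
| "bval b s \<Longrightarrow> steps c1 s n s' \<Longrightarrow> steps (Cond b c1 c2) s (n + 1) s'"
| "\<not> bval b s \<Longrightarrow> steps c2 s n s' \<Longrightarrow> steps (Cond b c1 c2) s (n + 1) s'"
| "\<not> bval b s \<Longrightarrow> steps (While b c) s 1 s"
| "bval b s1 \<Longrightarrow> steps c s1 n1 s2 \<Longrightarrow> steps (While b c) s2 n2 s3 \<Longrightarrow>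
    steps (While b c) s1 (n1 + n2 + 1) s3"

text \<open>A constant counts with its value and not as one node, so that a single number bounds
  both the subexpressions to be charged and the values they can take.\<close>

fun asize :: "aexp \<Rightarrow> nat" where
  "asize (Const n) = Suc n"
| "asize (Read x i) = Suc (asize i)"
| "asize (Add a b) = Suc (asize a + asize b)"
| "asize (Sub a b) = Suc (asize a + asize b)"

fun bsize :: "bexp \<Rightarrow> nat" where
  "bsize (Less a b) = Suc (asize a + asize b)"
| "bsize (BNot b) = Suc (bsize b)"
| "bsize (BAnd a b) = Suc (bsize a + bsize b)"

definition bounded :: "state \<Rightarrow> nat \<Rightarrow> bool" where
  "bounded s M \<longleftrightarrow> (\<forall>x i. s x i \<le> M)"

text \<open>Without sums of two memory cells on the right-hand side of an assignment, the contents of the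
  memory grow at most linearly in the number of steps, so their bit lengths stay small.\<close>

fun gentle :: "nat \<Rightarrow> com \<Rightarrow> bool" where
  "gentle K Skip \<longleftrightarrow> True"
| "gentle K (Write x i a) \<longleftrightarrow>
     asize i + asize a \<le> K \<and> (\<forall>s M. bounded s M \<longrightarrow> aval a s \<le> M + K)"
| "gentle K (Seq c1 c2) \<longleftrightarrow> gentle K c1 \<and> gentle K c2"
| "gentle K (Cond b c1 c2) \<longleftrightarrow> bsize b \<le> K \<and> gentle K c1 \<and> gentle K c2"
| "gentle K (While b c) \<longleftrightarrow> bsize b \<le> K \<and> gentle K c"

lemma boundedD: "bounded s M \<Longrightarrow> s x i \<le> M"
  by (simp add: bounded_def)

lemma bounded_mono: "bounded s M \<Longrightarrow> M \<le> M' \<Longrightarrow> bounded s M'"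
  unfolding bounded_def by (intro allI) (rule order_trans[of _ M], auto)

section \<open>Bit lengths, and the cost of expressions over bounded memory\<close>

lemma len_mono: "m \<le> n \<Longrightarrow> len m \<le> len n"
  by (simp add: len_def floorlog_mono)

lemma len_pos: "1 \<le> len n"
  by (simp add: len_def)

lemma less_power_len: "n < 2 ^ (len n - 1)"
  using floorlog_leD[of 2 n "floorlog 2 n"] by (simp add: len_def)

lemma len_le_Suc: "n < 2 ^ w \<Longrightarrow> len n \<le> Suc w"
  by (simp add: len_def floorlog_leI)

lemma len_le: "len n \<le> Suc n"
  by (rule len_le_Suc) (rule less_exp)

lemma len_Suc: "len (Suc n) \<le> Suc (len n)"
proof -
  have "Suc n < 2 ^ len n"
    using less_power_len[of n] len_pos[of n] by (cases "len n") auto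
  then show ?thesis by (rule len_le_Suc)
qed

lemma len_mult: "len (m * n) \<le> len m + len n"
proof -
  have "m * n < 2 ^ (len m - 1) * 2 ^ (len n - 1)"
    by (intro mult_strict_mono less_power_len) auto
  then have "len (m * n) \<le> Suc (len m - 1 + (len n - 1))"
    by (intro len_le_Suc) (simp add: power_add)
  with len_pos[of m] len_pos[of n] show ?thesis by linarith
qed

lemma aval_le: "bounded s M \<Longrightarrow> aval a s \<le> asize a * Suc M"
proof (induction a)
  case (Const n)
  then show ?case by simp
next
  case (Read x a)
  then show ?case by (simp add: boundedD trans_le_add1 trans_le_add2 le_SucI)
next
  case (Add a b)
  then show ?case by (simp add: algebra_simps)
next
  case (Sub a b)
  then have "aval a s \<le> asize a * Suc M" by simp
  also have "\<dots> \<le> asize (Sub a b) * Suc M" by (intro mult_right_mono) auto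
  finally show ?case by simp
qed

lemma acost_le:
  assumes "bounded s M" "asize a \<le> K"
  shows "acost a s \<le> asize a * len (K * Suc M)"
  using assms(2)
proof (induction a)
  case (Const n)
  have "aval (Const n) s \<le> K * Suc M"
    using aval_le[OF assms(1), of "Const n"] mult_right_mono[OF Const, of "Suc M"] by simp
  then show ?case
    using len_mono[of n "K * Suc M"] by (simp add: le_add1 trans_le_add1)
next
  case (Read x a)
  have "aval (Read x a) s \<le> K * Suc M"
    using aval_le[OF assms(1), of "Read x a"] mult_right_mono[OF Read.prems, of "Suc M"] by linarith
  from len_mono[OF this] Read show ?case by simp
next
  case (Add a b)
  have "aval (Add a b) s \<le> K * Suc M"
    using aval_le[OF assms(1), of "Add a b"] mult_right_mono[OF Add.prems, of "Suc M"] by linarith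
  from len_mono[OF this] Add show ?case by (simp add: algebra_simps)
next
  case (Sub a b)
  have "aval (Sub a b) s \<le> K * Suc M"
    using aval_le[OF assms(1), of "Sub a b"] mult_right_mono[OF Sub.prems, of "Suc M"] by linarith
  from len_mono[OF this] Sub show ?case by (simp add: algebra_simps)
qed

lemma bcost_le:
  assumes "bounded s M" "bsize b \<le> K"
  shows "bcost b s \<le> bsize b * len (K * Suc M)"
  using assms(2)
proof (induction b)
  case (Less a b)
  then show ?case
    using acost_le[OF assms(1), of a K] acost_le[OF assms(1), of b K] len_pos[of "K * Suc M"]
    by (simp add: add_mult_distrib del: mult_Suc_right)
next
  case (BNot b)
  then show ?case using len_pos[of "K * Suc M"] by (simp del: mult_Suc_right)
next
  case (BAnd a b)
  then show ?case using len_pos[of "K * Suc M"] by (simp add: add_mult_distrib del: mult_Suc_right)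
qed

text \<open>Each step raises the largest stored value by at most \<open>K\<close>, so every value
  met during the run stays below \<open>K * Suc R\<close>. Fixing the final bound \<open>R\<close>
  in advance gives all steps the same price, and the induction merely adds prices up; the current
  bound \<open>M\<close> varies along the run. The \<open>Suc\<close> in \<open>Suc K\<close> pays
  for the unit overhead of each command.\<close>

lemma exec_of_steps:
  assumes "steps c s n s'" "gentle K c" "bounded s M" "M + K * n \<le> R"
  shows "bounded s' (M + K * n) \<and> (\<exists>t. exec c s t s' \<and> t \<le> n * (Suc K * len (K * Suc R)))"
  using assms
proof (induction arbitrary: M rule: steps.induct)
  case (1 s)
  then show ?case using exec.Skip[of s] len_pos[of "K * Suc R"]
    by (auto intro: bounded_mono intro!: exI[of _ 1])
next
  case (2 x i a s)
  have 1: "bounded s R" using 2(2,3) by (auto intro: bounded_mono)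
  have "aval a s \<le> M + K" using 2(1,2) by simp
  then have "bounded (s(x := (s x)(aval i s := aval a s))) (M + K * 1)"
    using 2(2) by (auto simp: bounded_def trans_le_add1)
  moreover have "acost i s + acost a s + 1 \<le> 1 * (Suc K * len (K * Suc R))"
  proof -
    have "acost i s + acost a s \<le> (asize i + asize a) * len (K * Suc R)"
      using acost_le[OF 1, of i K] acost_le[OF 1, of a K] 2(1) by (simp add: add_mult_distrib)
    also have "\<dots> \<le> K * len (K * Suc R)" using 2(1) by (intro mult_right_mono) auto
    finally show ?thesis using len_pos[of "K * Suc R"] by (simp del: mult_Suc_right)
  qed
  ultimately show ?case using exec.Write[of x i a s] by blast
next
  case (3 c1 s1 n1 s2 c2 n2 s3)
  from 3(5-7) have "gentle K c1" "gentle K c2" and le: "M + K * n1 + K * n2 \<le> R"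
    by (auto simp: algebra_simps)
  then obtain t1 where 1: "bounded s2 (M + K * n1)" "exec c1 s1 t1 s2"
    "t1 \<le> n1 * (Suc K * len (K * Suc R))"
    using 3(3)[of M] 3(6) by auto
  with 3(4)[OF \<open>gentle K c2\<close> 1(1) le] obtain t2 where
    2: "bounded s3 (M + K * n1 + K * n2)" "exec c2 s2 t2 s3" "t2 \<le> n2 * (Suc K * len (K * Suc R))"
    by auto
  have "t1 + t2 \<le> (n1 + n2) * (Suc K * len (K * Suc R))"
    using 1(3) 2(3) by (simp add: add_mult_distrib)
  with exec.Seq[OF 1(2) 2(2)] 2(1) show ?case
    by (auto simp: algebra_simps)
next
  case (4 b s c1 n s' c2)
  have 1: "bounded s R" "bsize b \<le> K" using 4(4-6) by (auto intro: bounded_mono)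
  obtain t where 2: "bounded s' (M + K * n)" "exec c1 s t s'" "t \<le> n * (Suc K * len (K * Suc R))"
    using 4(3)[of M] 4(4-6) by auto
  have "bcost b s \<le> K * len (K * Suc R)"
    using bcost_le[OF 1] mult_right_mono[OF 1(2), of "len (K * Suc R)"] by linarith
  then have "bcost b s + t + 1 \<le> (n + 1) * (Suc K * len (K * Suc R))"
    using 2(3) len_pos[of "K * Suc R"] by (simp add: add_mult_distrib del: mult_Suc_right)
  with exec.CondTrue[OF 4(1) 2(2)] 2(1) show ?case
    by (auto intro: bounded_mono)
next
  case (5 b s c2 n s' c1)
  have 1: "bounded s R" "bsize b \<le> K" using 5(4-6) by (auto intro: bounded_mono)
  obtain t where 2: "bounded s' (M + K * n)" "exec c2 s t s'" "t \<le> n * (Suc K * len (K * Suc R))"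
    using 5(3)[of M] 5(4-6) by auto
  have "bcost b s \<le> K * len (K * Suc R)"
    using bcost_le[OF 1] mult_right_mono[OF 1(2), of "len (K * Suc R)"] by linarith
  then have "bcost b s + t + 1 \<le> (n + 1) * (Suc K * len (K * Suc R))"
    using 2(3) len_pos[of "K * Suc R"] by (simp add: add_mult_distrib del: mult_Suc_right)
  with exec.CondFalse[OF 5(1) 2(2)] 2(1) show ?case
    by (auto intro: bounded_mono)
next
  case (6 b s c)
  have 1: "bounded s R" "bsize b \<le> K" using 6(2-4) by (auto intro: bounded_mono)
  have "bcost b s \<le> K * len (K * Suc R)"
    using bcost_le[OF 1] mult_right_mono[OF 1(2), of "len (K * Suc R)"] by linarith
  then have "bcost b s + 1 \<le> 1 * (Suc K * len (K * Suc R))"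
    using len_pos[of "K * Suc R"] by (simp del: mult_Suc_right)
  with exec.WhileFalse[OF 6(1), of c] 6(3) show ?case
    by (auto intro: bounded_mono)
next
  case (7 b s1 c n1 s2 n2 s3)
  have 0: "bounded s1 R" "bsize b \<le> K" "gentle K c" and le: "M + K * n1 + K * n2 \<le> R"
    using 7(6-8) by (auto intro: bounded_mono simp: algebra_simps)
  then obtain t1 where 1: "bounded s2 (M + K * n1)" "exec c s1 t1 s2"
    "t1 \<le> n1 * (Suc K * len (K * Suc R))"
    using 7(4)[of M] 7(7) by auto
  with 7(5)[OF 7(6) 1(1) le] obtain t2 where
    2: "bounded s3 (M + K * n1 + K * n2)" "exec (While b c) s2 t2 s3"
      "t2 \<le> n2 * (Suc K * len (K * Suc R))"
    by auto
  have "bcost b s1 \<le> K * len (K * Suc R)"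
    using bcost_le[OF 0(1,2)] mult_right_mono[OF 0(2), of "len (K * Suc R)"] by linarith
  then have "bcost b s1 + t1 + t2 + 1 \<le> (n1 + n2 + 1) * (Suc K * len (K * Suc R))"
    using 1(3) 2(3) len_pos[of "K * Suc R"] by (simp add: add_mult_distrib del: mult_Suc_right)
  with exec.WhileTrue[OF 7(1) 1(2) 2(2)] 2(1) show ?case
    by (auto simp: algebra_simps intro: bounded_mono)
qed

section \<open>Total correctness with polynomially many steps\<close>

fun writes :: "com \<Rightarrow> vname set" where
  "writes Skip = {}"
| "writes (Write x i a) = {x}"
| "writes (Seq c1 c2) = writes c1 \<union> writes c2"
| "writes (Cond b c1 c2) = writes c1 \<union> writes c2"
| "writes (While b c) = writes c"

text \<open>The number of steps of a program, as a polynomial in a common bound on the number of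
  iterations of each execution of a loop.\<close>

fun step_poly :: "com \<Rightarrow> nat poly" where
  "step_poly Skip = 1"
| "step_poly (Write x i a) = 1"
| "step_poly (Seq c1 c2) = step_poly c1 + step_poly c2"
| "step_poly (Cond b c1 c2) = step_poly c1 + step_poly c2 + 1"
| "step_poly (While b c) = [:0, 1:] * (step_poly c + 1) + 1"

text \<open>The budget depends only on the program text and on \<open>B\<close>. Thus time never
  appears in the assertions; the only obligation that remains is that each loop iterates at most
  \<open>B\<close> times.\<close>

definition wp :: "nat \<Rightarrow> com \<Rightarrow> (state \<Rightarrow> bool) \<Rightarrow> state \<Rightarrow> bool" where
  "wp B c Q s \<longleftrightarrow> (\<exists>n s'. n \<le> poly (step_poly c) B \<and> steps c s n s' \<and> Q s')"

lemma steps_frame: "steps c s n s' \<Longrightarrow> x \<notin> writes c \<Longrightarrow> s' x = s x"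
  by (induction rule: steps.induct) auto

lemma wp_frame:
  assumes "wp B c Q s" "\<And>s'. Q s' \<Longrightarrow> (\<And>x. x \<notin> writes c \<Longrightarrow> s' x = s x) \<Longrightarrow> Q' s'"
  shows "wp B c Q' s"
proof -
  from assms(1) obtain n s' where "n \<le> poly (step_poly c) B" "steps c s n s'" "Q s'"
    unfolding wp_def by blast
  with assms(2)[OF this(3)] steps_frame[OF this(2)] show ?thesis
    unfolding wp_def by blast
qed

lemma wp_mono: "wp B c Q s \<Longrightarrow> (\<And>s'. Q s' \<Longrightarrow> Q' s') \<Longrightarrow> wp B c Q' s"
  by (rule wp_frame)

lemma wp_Skip: "Q s \<Longrightarrow> wp B Skip Q s"
  unfolding wp_def using steps.intros(1)[of s] by (intro exI[of _ 1] exI[of _ s]) simp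

lemma wp_Write: "Q (s(x := (s x)(aval i s := aval a s))) \<Longrightarrow> wp B (Write x i a) Q s"
  unfolding wp_def using steps.intros(2)[of x i a s] by (intro exI[of _ 1] exI) auto

lemma wp_Seq:
  assumes "wp B c1 (wp B c2 Q) s"
  shows "wp B (Seq c1 c2) Q s"
proof -
  from assms obtain n1 s1 n2 s2 where
    "n1 \<le> poly (step_poly c1) B" "steps c1 s n1 s1" "n2 \<le> poly (step_poly c2) B" "steps c2 s1 n2 s2" "Q s2"
    unfolding wp_def by blast
  with steps.intros(3)[of c1 s n1 s1 c2 n2 s2] show ?thesis
    unfolding wp_def by (intro exI[of _ "n1 + n2"] exI[of _ s2]) auto
qed

lemma wp_Cond:
  assumes "bval b s \<Longrightarrow> wp B c1 Q s" "\<not> bval b s \<Longrightarrow> wp B c2 Q s"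
  shows "wp B (Cond b c1 c2) Q s"
proof (cases "bval b s")
  case True
  with assms(1) obtain n s' where n: "n \<le> poly (step_poly c1) B" "steps c1 s n s'" "Q s'"
    unfolding wp_def by auto
  with steps.intros(4)[OF True n(2)] show ?thesis
    unfolding wp_def by (intro exI[of _ "n + 1"] exI[of _ s']) auto
next
  case False
  with assms(2) obtain n s' where n: "n \<le> poly (step_poly c2) B" "steps c2 s n s'" "Q s'"
    unfolding wp_def by auto
  with steps.intros(5)[OF False n(2)] show ?thesis
    unfolding wp_def by (intro exI[of _ "n + 1"] exI[of _ s']) auto
qed

text \<open>The invariant is indexed by the number of completed iterations, whose total
  \<open>n\<close> is fixed beforehand. This gives termination and the step bound without a separate
  variant.\<close>

lemma wp_While:
  assumes "n \<le> B" "I 0 s"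
    and step: "\<And>i s. i < n \<Longrightarrow> I i s \<Longrightarrow> bval b s \<and> wp B c (I (Suc i)) s"
    and final: "\<And>s. I n s \<Longrightarrow> \<not> bval b s \<and> Q s"
  shows "wp B (While b c) Q s"
proof -
  let ?T = "poly (step_poly c) B + 1"
  have "\<exists>l s'. l \<le> k * ?T + 1 \<and> steps (While b c) s l s' \<and> Q s'" if "I (n - k) s" "k \<le> n" for k s
    using that
  proof (induction k arbitrary: s)
    case 0
    then show ?case using final[of s] steps.intros(6)[of b s c] by (intro exI[of _ 1] exI[of _ s]) auto
  next
    case (Suc k)
    from step[of "n - Suc k" s] Suc.prems obtain l1 s1 where
      1: "bval b s" "l1 \<le> poly (step_poly c) B" "steps c s l1 s1" "I (n - k) s1"
      unfolding wp_def by (auto simp: Suc_diff_Suc)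
    from Suc.IH[OF 1(4)] Suc.prems obtain l2 s2 where
      2: "l2 \<le> k * ?T + 1" "steps (While b c) s1 l2 s2" "Q s2" by auto
    from steps.intros(7)[OF 1(1,3) 2(2)] 1(2) 2 show ?case
      by (intro exI[of _ "l1 + l2 + 1"] exI[of _ s2]) auto
  qed
  from this[of n s] assms(2) obtain l s' where
    "l \<le> n * ?T + 1" "steps (While b c) s l s'" "Q s'" by auto
  moreover have "n * ?T + 1 \<le> poly (step_poly (While b c)) B"
    using mult_right_mono[OF assms(1), of ?T] by simp
  ultimately show ?thesis unfolding wp_def by (meson le_trans)
qed

abbreviation Var :: "vname \<Rightarrow> aexp" where
  "Var x \<equiv> Read x (Const 0)"

abbreviation Assign :: "vname \<Rightarrow> aexp \<Rightarrow> com" (infix "::=" 61) where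
  "x ::= a \<equiv> Write x (Const 0) a"

notation Seq (infixr ";;" 60)

definition For :: "vname \<Rightarrow> aexp \<Rightarrow> com \<Rightarrow> com" where
  "For x a c = (x ::= Const 0 ;; While (Less (Var x) a) (c ;; x ::= Add (Var x) (Const 1)))"

lemma writes_For [simp]: "writes (For x a c) = insert x (writes c)"
  by (auto simp: For_def)

lemma gentle_For [simp]:
  assumes "3 + asize a \<le> K" "8 \<le> K"
  shows "gentle K (For x a c) \<longleftrightarrow> gentle K c"
proof -
  have "Suc (s x 0) \<le> M + K" if "bounded s M" for s M
    using boundedD[OF that, of x 0] assms(2) by simp
  then show ?thesis using assms by (auto simp: For_def)
qed

text \<open>The counter is advanced after the body, so the body has to establish the invariant for
  the state in which that update has already taken place. The limit \<open>a\<close> is evaluated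
  anew in every test; \<open>bound\<close> says that the invariant pins its value down.\<close>

lemma wp_For:
  assumes "x \<notin> writes c" "n \<le> B"
    and init: "I 0 (s(x := (s x)(0 := 0)))"
    and bound: "\<And>i s. I i s \<Longrightarrow> aval a s = n"
    and step: "\<And>i s. i < n \<Longrightarrow> I i s \<Longrightarrow> s x 0 = i \<Longrightarrow>
      wp B c (\<lambda>s'. I (Suc i) (s'(x := (s' x)(0 := Suc i)))) s"
    and final: "\<And>s'. I n s' \<Longrightarrow> Q s'"
  shows "wp B (For x a c) Q s"
  unfolding For_def
proof (intro wp_Seq wp_Write wp_While[where n = n and I = "\<lambda>i s. I i s \<and> s x 0 = i"])
  show "n \<le> B" by fact
  show "I 0 (s(x := (s x)(aval (Const 0) s := aval (Const 0) s))) \<and>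
    (s(x := (s x)(aval (Const 0) s := aval (Const 0) s))) x 0 = 0"
    using init by simp
next
  fix i s assume i: "i < n" and "I i s \<and> s x 0 = i"
  then have I: "I i s" "s x 0 = i" by auto
  show "bval (Less (Var x) a) s \<and> wp B (c ;; x ::= Add (Var x) (Const 1)) (\<lambda>s. I (Suc i) s \<and> s x 0 = Suc i) s"
  proof
    show "bval (Less (Var x) a) s" using bound[OF I(1)] I(2) i by simp
    show "wp B (c ;; x ::= Add (Var x) (Const 1)) (\<lambda>s. I (Suc i) s \<and> s x 0 = Suc i) s"
      by (rule wp_Seq, rule wp_frame[OF step[OF i I]], rule wp_Write)
        (use assms(1) I(2) in auto)
  qed
next
  fix s assume "I n s \<and> s x 0 = n"
  then show "\<not> bval (Less (Var x) a) s \<and> Q s" using bound[of n s] final by auto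
qed

section \<open>Combinatorics of the algorithm\<close>

definition verts :: "'a list list \<Rightarrow> nat set \<Rightarrow> 'a set" where
  "verts es J = (\<Union>j\<in>J. set (es ! j))"

lemma finite_verts [simp]: "finite J \<Longrightarrow> finite (verts es J)"
  by (simp add: verts_def)

lemma verts_mono: "J \<subseteq> J' \<Longrightarrow> verts es J \<subseteq> verts es J'"
  by (auto simp: verts_def)

text \<open>Invariant of the load distribution after \<open>r\<close> full rounds and \<open>i\<close> further edges. For the second
  part, note that an edge with some vertex of load less than \<open>A\<close> has always put its unit on a vertex
  of load less than \<open>A\<close>, as loads only grow.\<close>

definition balanced :: "'a list list \<Rightarrow> nat \<Rightarrow> nat \<Rightarrow> ('a \<Rightarrow> nat) \<Rightarrow> bool" where
  "balanced es r i f \<longleftrightarrow>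
     (\<forall>W. finite W \<longrightarrow> sum f W \<le> r * length es + i) \<and>
     (\<forall>A J. J \<subseteq> {..<length es} \<longrightarrow> (\<forall>j\<in>J. \<exists>v\<in>set (es ! j). f v < A) \<longrightarrow>
        r * card J + card (J \<inter> {..<i}) \<le> (\<Sum>v\<in>verts es J. min (f v) A))"

lemma balanced_0: "balanced es 0 0 (\<lambda>_. 0)"
  by (simp add: balanced_def)

lemma balanced_round:
  assumes "balanced es r (length es) f"
  shows "balanced es (Suc r) 0 f"
  using assms unfolding balanced_def by (auto simp: Int_absorb2 add.commute)

text \<open>An empty edge has no vertex of load less than \<open>A\<close>, so it lies in none of
  the sets \<open>J\<close> of the second part and the count there does not change.\<close>

lemma balanced_empty:
  assumes "balanced es r i f" "es ! i = []"
  shows "balanced es r (Suc i) f"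
proof -
  have "J \<inter> {..<Suc i} = J \<inter> {..<i}" if "\<forall>j\<in>J. \<exists>v\<in>set (es ! j). f v < A" for J A
  proof -
    have "i \<notin> J"
    proof
      assume "i \<in> J"
      with that assms(2) show False by auto
    qed
    then show ?thesis by (simp add: lessThan_Suc)
  qed
  with assms(1) show ?thesis unfolding balanced_def by (auto simp: le_SucI)
qed

text \<open>Only sets \<open>J\<close> containing \<open>i\<close> need a new unit. By assumption
  edge \<open>i\<close> has a vertex whose new load is less than \<open>A\<close>; its old load is
  no larger, and \<open>v\<close> was least loaded, so \<open>v\<close> had load less than
  \<open>A\<close> too. Hence its truncated load \<open>min (f v) A\<close> really grows by
  one.\<close>

lemma balanced_step:
  assumes bal: "balanced es r i f" and v: "v \<in> set (es ! i)" and le: "\<And>w. w \<in> set (es ! i) \<Longrightarrow> f v \<le> f w"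
  shows "balanced es r (Suc i) (f(v := Suc (f v)))"
  unfolding balanced_def
proof (intro conjI allI impI)
  fix W :: "'a set" assume W: "finite W"
  have "sum (f(v := Suc (f v))) W \<le> Suc (sum f W)"
  proof (cases "v \<in> W")
    case True
    have "sum (f(v := Suc (f v))) (W - {v}) = sum f (W - {v})"
      by (rule sum.cong) auto
    then show ?thesis
      using sum.remove[OF W True, of f] sum.remove[OF W True, of "f(v := Suc (f v))"] by simp
  next
    case False
    then have "sum (f(v := Suc (f v))) W = sum f W" by (intro sum.cong) auto
    then show ?thesis by simp
  qed
  with bal W show "sum (f(v := Suc (f v))) W \<le> r * length es + Suc i"
    unfolding balanced_def by (metis Suc_le_mono add_Suc_right le_trans)
next
  fix A J
  assume J: "J \<subseteq> {..<length es}" and low: "\<forall>j\<in>J. \<exists>w\<in>set (es ! j). (f(v := Suc (f v))) w < A"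
  let ?g = "\<lambda>w. min ((f(v := Suc (f v))) w) A"
  have fin: "finite J" using J finite_subset by blast
  have "\<forall>j\<in>J. \<exists>w\<in>set (es ! j). f w < A"
  proof
    fix j assume "j \<in> J"
    with low obtain w where w: "w \<in> set (es ! j)" "(f(v := Suc (f v))) w < A" by blast
    then have "f w < A" by (auto split: if_splits)
    with w show "\<exists>w\<in>set (es ! j). f w < A" by blast
  qed
  with bal J have IH: "r * card J + card (J \<inter> {..<i}) \<le> (\<Sum>w\<in>verts es J. min (f w) A)"
    unfolding balanced_def by blast
  have mono: "(\<Sum>w\<in>X. min (f w) A) \<le> (\<Sum>w\<in>X. ?g w)" for X
    by (rule sum_mono) auto
  show "r * card J + card (J \<inter> {..<Suc i}) \<le> (\<Sum>w\<in>verts es J. ?g w)"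
  proof (cases "i \<in> J")
    case True
    then have "J \<inter> {..<Suc i} = insert i (J \<inter> {..<i})" by auto
    then have "card (J \<inter> {..<Suc i}) = Suc (card (J \<inter> {..<i}))" by simp
    moreover have "(\<Sum>w\<in>verts es J. ?g w) \<ge> Suc (\<Sum>w\<in>verts es J. min (f w) A)"
    proof -
      have vin: "v \<in> verts es J" using True v by (auto simp: verts_def)
      from True low obtain w where w: "w \<in> set (es ! i)" "(f(v := Suc (f v))) w < A" by blast
      then have "f v < A" using le[of w] by (auto split: if_splits)
      then have "?g v = Suc (min (f v) A)" by simp
      then show ?thesis
        using mono[of "verts es J - {v}"] sum.remove[OF finite_verts[OF fin] vin, of ?g]
          sum.remove[OF finite_verts[OF fin] vin, of "\<lambda>w. min (f w) A"] by simp
    qed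
    ultimately show ?thesis using IH by simp
  next
    case False
    then have "J \<inter> {..<Suc i} = J \<inter> {..<i}" by (simp add: lessThan_Suc)
    with IH mono[of "verts es J"] show ?thesis by simp
  qed
qed

section \<open>Greedy selection by descending thresholds\<close>

definition above :: "nat \<Rightarrow> (nat \<Rightarrow> nat) \<Rightarrow> nat \<Rightarrow> nat set" where
  "above m key A = {j. j < m \<and> A \<le> key j}"

text \<open>Indices below \<open>m\<close> are added to \<open>J0\<close> in the order of decreasing keys, as long as there are fewer
  than \<open>q\<close>; the current threshold is \<open>t\<close>, and the indices below \<open>i\<close> have been examined for it.\<close>

definition greedy ::
  "nat \<Rightarrow> nat \<Rightarrow> (nat \<Rightarrow> nat) \<Rightarrow> nat set \<Rightarrow> nat \<Rightarrow> nat \<Rightarrow> nat set \<Rightarrow> bool" where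
  "greedy m q key J0 t i J \<longleftrightarrow>
     J0 \<subseteq> J \<and> J \<subseteq> {..<m} \<and> card J \<le> max (card J0) q \<and>
     (q \<le> card J \<or> above m key (Suc t) \<union> above m key t \<inter> {..<i} \<subseteq> J) \<and>
     (\<forall>A\<ge>1. q \<le> card (J0 \<union> above m key A) \<longrightarrow> J \<subseteq> J0 \<union> above m key A)"

lemma greedy_start:
  assumes "J0 \<subseteq> {..<m}" "\<And>j. j < m \<Longrightarrow> key j \<le> t"
  shows "greedy m q key J0 t 0 J0"
proof -
  have "above m key (Suc t) = {}" using assms(2) by (fastforce simp: above_def)
  with assms(1) show ?thesis by (auto simp: greedy_def)
qed

text \<open>For \<open>A\<close> at most \<open>t\<close> the new index itself lies in
  \<open>above m key A\<close>. For larger \<open>A\<close> that whole set has been taken before;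
  with fewer than \<open>q\<close> indices in \<open>J\<close>, the premise of the last clause of
  \<open>greedy\<close> then fails.\<close>

lemma greedy_insert:
  assumes g: "greedy m q key J0 t i J" and i: "i < m" "card J < q" "i \<notin> J" "t \<le> key i"
  shows "greedy m q key J0 t (Suc i) (insert i J)"
proof -
  have J: "J0 \<subseteq> J" "J \<subseteq> {..<m}" "finite J" and sub: "above m key (Suc t) \<union> above m key t \<inter> {..<i} \<subseteq> J"
    using g i(2) finite_subset[of J "{..<m}"] by (auto simp: greedy_def)
  have "i \<in> above m key A" if A: "q \<le> card (J0 \<union> above m key A)" for A
  proof (cases "A \<le> t")
    case True
    then show ?thesis using i by (simp add: above_def)
  next
    case False
    then have "above m key A \<subseteq> above m key (Suc t)" by (auto simp: above_def)
    with sub J(1) have "J0 \<union> above m key A \<subseteq> J" by blast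
    from card_mono[OF J(3) this] A i(2) show ?thesis by simp
  qed
  moreover have "above m key t \<inter> {..<Suc i} \<subseteq> insert i (above m key t \<inter> {..<i})" by auto
  ultimately show ?thesis
    using g i J sub unfolding greedy_def by (auto simp: less_Suc_eq)
qed

lemma greedy_skip:
  assumes "greedy m q key J0 t i J" "\<not> (card J < q \<and> i \<notin> J \<and> t \<le> key i)"
  shows "greedy m q key J0 t (Suc i) J"
  using assms unfolding greedy_def by (auto simp: less_Suc_eq above_def)

lemma greedy_lower:
  assumes "greedy m q key J0 (Suc t) m J"
  shows "greedy m q key J0 t 0 J"
proof -
  have "above m key (Suc t) \<inter> {..<m} = above m key (Suc t)" by (auto simp: above_def)
  with assms show ?thesis unfolding greedy_def by auto
qed

text \<open>A completed sweep has treated all thresholds down to 1. Indices with key 0 are never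
  examined, which is why \<open>A\<close> has to be positive.\<close>

lemma greedy_card:
  assumes "greedy m q key J0 0 0 J" "1 \<le> A" "q \<le> card (J0 \<union> above m key A)"
  shows "q \<le> card J"
proof (rule ccontr)
  assume "\<not> q \<le> card J"
  with assms(1) have J: "above m key 1 \<subseteq> J" "J0 \<subseteq> J" "J \<subseteq> {..<m}" by (auto simp: greedy_def)
  moreover have "above m key A \<subseteq> above m key 1" using assms(2) by (auto simp: above_def)
  ultimately have "card (J0 \<union> above m key A) \<le> card J"
    by (intro card_mono) (auto intro: finite_subset)
  with assms(3) \<open>\<not> q \<le> card J\<close> show False by simp
qed

lemma card_verts_le:
  assumes "finite J" "\<And>j. j \<in> J \<Longrightarrow> length (es ! j) \<le> k"
  shows "card (verts es J) \<le> card J * k"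
proof -
  have "card (verts es J) \<le> (\<Sum>j\<in>J. card (set (es ! j)))"
    unfolding verts_def by (rule card_UN_le[OF assms(1)])
  also have "\<dots> \<le> (\<Sum>j\<in>J. k)"
    by (intro sum_mono) (meson assms(2) card_length le_trans)
  finally show ?thesis by simp
qed

text \<open>The constant 5 is 1 for the edges added in the second phase and 4 for those of the
  first: a factor two for rounding in \<open>A\<close>, and a factor two from
  \<open>m \<le> 2 * (s * s)\<close>. The key of an edge is specified only for thresholds up to
  \<open>N * m\<close>, because the minimum load of an empty edge would be infinite.\<close>

lemma selection_bound:
  fixes es :: "'a list list"
  defines "m \<equiv> length es"
  assumes distinct: "distinct (map set es)" "\<And>j. j < m \<Longrightarrow> distinct (es ! j)"
    and N: "\<And>j. j < m \<Longrightarrow> length (es ! j) \<le> N"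
    and bal: "balanced es N 0 f"
    and s: "2 * m = s * s + s + 2 * b" "b \<le> s"
    and opt: "J \<subseteq> {..<m}" "card J = p" "card (verts es J) = k" "k \<le> N"
    and key1: "\<And>j A. j < m \<Longrightarrow> A \<le> N * m \<Longrightarrow> A \<le> key1 j \<longleftrightarrow> (\<forall>v\<in>set (es ! j). A \<le> f v)"
    and key2: "\<And>j. j < m \<Longrightarrow> key2 j = Suc N - length (es ! j)"
    and J1: "greedy m (p - s) key1 {} 0 0 J1"
    and J2: "greedy m p key2 J1 0 0 J2"
  shows "card J2 = p" "card (verts es J2) \<le> 5 * s * k"
proof -
  have fin: "finite J" "finite J1" "finite J2"
    using opt(1) J1 J2 finite_subset[of _ "{..<m}"] by (auto simp: greedy_def)
  have pm: "p \<le> m" using card_mono[OF _ opt(1)] opt(2) by simp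
  have c1: "card J1 \<le> p - s" and J1sub: "J1 \<subseteq> J2" "J2 \<subseteq> {..<m}" "J1 \<subseteq> {..<m}"
    using J1 J2 by (auto simp: greedy_def)
  \<comment> \<open>The \<open>Suc\<close> in \<open>key2\<close> keeps the key positive even for an
    edge of size \<open>N\<close>, so the second phase cannot run out of edges before reaching
    \<open>p\<close>.\<close>
  have "above m key2 1 = {..<m}" using key2 N by (fastforce simp: above_def)
  with greedy_card[OF J2, of 1] pm J1sub(3) have "p \<le> card J2"
    by (simp add: Un_absorb1)
  moreover have "card J2 \<le> p" using J2 c1 by (auto simp: greedy_def)
  ultimately show cJ2: "card J2 = p" by simp
  have lenJ: "length (es ! j) \<le> k" if "j \<in> J" for j
  proof -
    have "set (es ! j) \<subseteq> verts es J" using that by (auto simp: verts_def)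
    from card_mono[OF finite_verts[OF fin(1)] this] show ?thesis
      using distinct(2)[of j] opt that by (auto simp: distinct_card)
  qed
  \<comment> \<open>In terms of \<open>key2\<close> this threshold means size at most
    \<open>k\<close>; it is positive because of \<open>k \<le> N\<close>.\<close>
  let ?A2 = "Suc N - k"
  have "J \<subseteq> above m key2 ?A2"
    using lenJ opt(1) key2 by (fastforce simp: above_def)
  then have "p \<le> card (J1 \<union> above m key2 ?A2)"
    unfolding opt(2)[symmetric] using fin by (intro card_mono) (auto simp: above_def)
  then have "J2 \<subseteq> J1 \<union> above m key2 ?A2"
    using J2 opt(4) by (auto simp: greedy_def)
  then have "length (es ! j) \<le> k" if "j \<in> J2 - J1" for j
    using that key2[of j] N[of j] opt(4) by (auto simp: above_def subset_iff)
  then have new: "card (verts es (J2 - J1)) \<le> card (J2 - J1) * k"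
    using fin by (intro card_verts_le) auto
  have split: "card (verts es J2) \<le> card (verts es J1) + card (verts es (J2 - J1))"
  proof -
    have "verts es J2 = verts es J1 \<union> verts es (J2 - J1)" using J1sub by (auto simp: verts_def)
    then show ?thesis by (simp add: card_Un_le)
  qed
  show "card (verts es J2) \<le> 5 * s * k"
  proof (cases "p \<le> s")
    case True
    \<comment> \<open>The truncated difference \<open>p - s\<close> is zero, so the first phase
      selects nothing.\<close>
    then have "J1 = {}" using c1 fin by auto
    with new split cJ2 have "card (verts es J2) \<le> p * k" by (simp add: verts_def)
    also have "\<dots> \<le> (5 * s) * k" using True by (intro mult_right_mono) auto
    finally show ?thesis .
  next
    case False
    have s1: "1 \<le> s"
    proof (rule ccontr)
      assume "\<not> 1 \<le> s"
      then have "s = 0" by simp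
      with s pm False show False by simp
    qed
    \<comment> \<open>An empty optimal union would consist of empty edges only. Edges are distinct
      as sets, so there would be at most one, against \<open>p > s \<ge> 1\<close>.\<close>
    have k1: "1 \<le> k"
    proof (rule ccontr)
      assume "\<not> 1 \<le> k"
      then have "k = 0" by simp
      then have e: "es ! j = []" if "j \<in> J" for j using lenJ[OF that] by simp
      have "x = y" if "x \<in> J" "y \<in> J" for x y
      proof -
        have "map set es ! x = map set es ! y" "x < m" "y < m" using that e opt(1) by (auto simp: m_def)
        then show ?thesis using nth_eq_iff_index_eq[OF distinct(1), of x y] by (simp add: m_def)
      qed
      then have "card J \<le> 1" by (intro card_le_Suc0_iff_eq[THEN iffD2, folded One_nat_def]) (use fin in auto)
      with False s1 opt(2) show False by simp
    qed
    have N1: "1 \<le> N" using k1 opt(4) by simp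
    define A where "A = s * N div k"
    have kN: "k \<le> s * N" using mult_le_mono[OF s1 opt(4)] by simp
    have A1: "1 \<le> A" unfolding A_def using div_le_mono[OF kN, of k] k1 by simp
    have kA: "k * A \<le> s * N" unfolding A_def by simp
    \<comment> \<open>The remainder of the division is less than \<open>k\<close>, hence less than
      \<open>k * A\<close> as soon as \<open>A\<close> is positive; this is where
      \<open>k \<le> N\<close> limits the rounding loss.\<close>
    have sN: "s * N \<le> 2 * (k * A)"
    proof -
      have "s * N < k * Suc A" unfolding A_def
        using k1 by (metis One_nat_def Suc_le_lessD dividend_less_times_div mult_Suc_right)
      moreover have "k \<le> k * A" using mult_le_mono2[OF A1, of k] by simp
      ultimately show ?thesis unfolding mult_Suc_right by linarith
    qed
    have sm: "s \<le> m" using s s1 mult_le_mono1[OF s1, of s] by linarith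
    have AN: "A \<le> N * m"
    proof -
      have "A \<le> s * N" unfolding A_def by (rule div_le_dividend)
      also have "\<dots> \<le> N * m" using sm by (simp add: mult.commute)
      finally show ?thesis .
    qed
    have heavy: "above m key1 A = {j. j < m \<and> (\<forall>v\<in>set (es ! j). A \<le> f v)}"
      using key1 AN by (auto simp: above_def)
    let ?L = "J - above m key1 A"
    have "card ?L \<le> s"
    proof -
      have "\<forall>j\<in>?L. \<exists>v\<in>set (es ! j). f v < A" using opt(1) by (auto simp: heavy not_le)
      then have "N * card ?L \<le> (\<Sum>v\<in>verts es ?L. min (f v) A)"
        using bal opt(1) unfolding balanced_def m_def by (auto simp: Diff_subset_conv le_supI2)
      also have "\<dots> \<le> (\<Sum>v\<in>verts es ?L. A)" by (intro sum_mono) simp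
      also have "\<dots> = card (verts es ?L) * A" by simp
      also have "\<dots> \<le> k * A"
        unfolding opt(3)[symmetric] using fin by (intro mult_right_mono card_mono verts_mono) auto
      also note kA
      finally have "N * card ?L \<le> N * s" by (simp add: mult.commute)
      with N1 show ?thesis by simp
    qed
    moreover have "card J \<le> card ?L + card (above m key1 A)"
    proof -
      have "card J \<le> card (?L \<union> above m key1 A)"
        using fin by (intro card_mono) (auto simp: above_def)
      also have "\<dots> \<le> card ?L + card (above m key1 A)" by (rule card_Un_le)
      finally show ?thesis .
    qed
    ultimately have q: "p - s \<le> card ({} \<union> above m key1 A)" using opt(2) by simp
    then have J1A: "J1 \<subseteq> above m key1 A" using J1 A1 unfolding greedy_def by auto
    have "p - s \<le> card J1" by (rule greedy_card[OF J1 A1 q])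
    then have "card (J2 - J1) \<le> s"
      using card_Diff_subset[OF fin(2) J1sub(1)] cJ2 by simp
    then have "card (verts es (J2 - J1)) \<le> s * k" using new mult_right_mono le_trans by blast
    moreover have "card (verts es J1) \<le> 4 * s * k"
    proof -
      let ?c = "card (verts es J1)"
      have "A * ?c = (\<Sum>v\<in>verts es J1. A)" by simp
      also have "\<dots> \<le> (\<Sum>v\<in>verts es J1. f v)"
        using J1A by (intro sum_mono) (auto simp: heavy verts_def)
      also have "\<dots> \<le> N * m" using bal fin unfolding balanced_def m_def by auto
      finally have Ac: "A * ?c \<le> N * m" .
      \<comment> \<open>From \<open>b \<le> s\<close> and \<open>1 \<le> s\<close> one gets
        \<open>2 * m \<le> s * s + 3 * s \<le> 4 * (s * s)\<close>.\<close>
      have m2: "m \<le> 2 * (s * s)" using s mult_le_mono1[OF s1, of s] by linarith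
      have "(s * N) * ?c \<le> 2 * (k * A) * ?c" using sN by (rule mult_right_mono) simp
      also have "\<dots> = 2 * k * (A * ?c)" by simp
      also have "\<dots> \<le> 2 * k * (N * m)" using Ac by (rule mult_left_mono) simp
      also have "\<dots> \<le> 2 * k * (N * (2 * (s * s)))" using m2 by (intro mult_left_mono) auto
      finally have "(s * N) * ?c \<le> (s * N) * (4 * s * k)" by (simp add: algebra_simps)
      with s1 N1 show ?thesis by simp
    qed
    ultimately show ?thesis using split by (simp add: algebra_simps)
  qed
qed

section \<open>The program\<close>

text \<open>\<open>start\<close> holds the positions in the input at which the edges, including their lengths, begin;
  \<open>load\<close> is indexed by the names of the vertices. Selection takes edges with large keys first and
  stops at \<open>p - slack\<close> edges.\<close>

definition size_expr :: aexp where
  "size_expr = Read ''in'' (Read ''start'' (Var ''j''))"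

definition entry :: "aexp \<Rightarrow> aexp" where
  "entry a = Read ''in'' (Add (Read ''start'' (Var ''j'')) a)"

text \<open>Cell 2 of the input is the number of vertices, so the number of edges stands that many
  cells plus 3 from the start. Adding the size of an edge to \<open>pos\<close> at once would be a
  sum of two cells and not \<open>gentle\<close>; the inner loop counts instead.\<close>

definition offsets :: com where
  "offsets =
    (''m'' ::= Read ''in'' (Add (Read ''in'' (Const 2)) (Const 3)) ;;
     ''pos'' ::= Add (Read ''in'' (Const 2)) (Const 4) ;;
     For ''j'' (Var ''m'')
      (Write ''start'' (Var ''j'') (Var ''pos'') ;;
       For ''l'' size_expr (''pos'' ::= Add (Var ''pos'') (Const 1)) ;;
       ''pos'' ::= Add (Var ''pos'') (Const 1)))"

text \<open>A square root without multiplication: after \<open>i\<close> iterations, \<open>i = s (s + 1) / 2 + b\<close>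
  with \<open>b \<le> s\<close>.\<close>

definition root :: com where
  "root =
    (''s'' ::= Const 0 ;;
     ''b'' ::= Const 0 ;;
     For ''j'' (Var ''m'')
      (Cond (Less (Var ''b'') (Var ''s''))
        (''b'' ::= Add (Var ''b'') (Const 1))
        (''s'' ::= Add (Var ''s'') (Const 1) ;; ''b'' ::= Const 0)))"

text \<open>Here \<open>b\<close> is the position of the least loaded vertex seen so far, counted
  from 1 because position 0 of an edge is its length.\<close>

definition place_unit :: com where
  "place_unit =
    Cond (Less (Const 0) size_expr)
     (''b'' ::= Const 1 ;;
      For ''l'' size_expr
       (Cond (Less (Read ''load'' (entry (Add (Var ''l'') (Const 1)))) (Read ''load'' (entry (Var ''b''))))
         (''b'' ::= Add (Var ''l'') (Const 1)) Skip) ;;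
      Write ''load'' (entry (Var ''b'')) (Add (Read ''load'' (entry (Var ''b''))) (Const 1)))
     Skip"

text \<open>The counter \<open>t\<close> ends at \<open>N * m\<close>, a product obtained without
  multiplication; it bounds all loads and caps the keys.\<close>

definition balance :: com where
  "balance =
    For ''r'' (Read ''in'' (Const 0))
     (For ''j'' (Var ''m'') (place_unit ;; ''t'' ::= Add (Var ''t'') (Const 1)))"

definition lower_key :: com where
  "lower_key =
    Cond (Less (Read ''load'' (entry (Add (Var ''l'') (Const 1)))) (Read ''key'' (Var ''j'')))
     (Write ''key'' (Var ''j'') (Read ''load'' (entry (Add (Var ''l'') (Const 1))))) Skip"

text \<open>Starting from the cap \<open>t\<close> gives an empty edge the largest possible key, as
  is right for an edge that costs nothing.\<close>

definition load_keys :: com where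
  "load_keys =
    For ''j'' (Var ''m'')
     (Write ''key'' (Var ''j'') (Var ''t'') ;; For ''l'' size_expr lower_key)"

definition size_keys :: com where
  "size_keys =
    (''t'' ::= Add (Read ''in'' (Const 0)) (Const 1) ;;
     For ''j'' (Var ''m'') (Write ''key'' (Var ''j'') (Sub (Var ''t'') size_expr)))"

definition examine :: com where
  "examine =
    Cond
     (BAnd (Less (Add (Var ''cnt'') (Var ''slack'')) (Read ''in'' (Const 1)))
       (BAnd (Less (Read ''sel'' (Var ''j'')) (Const 1))
         (BNot (Less (Read ''key'' (Var ''j'')) (Var ''t'')))))
     (Write ''sel'' (Var ''j'') (Const 1) ;; ''cnt'' ::= Add (Var ''cnt'') (Const 1))
     Skip"

text \<open>Descending through all thresholds replaces sorting. It is affordable since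
  \<open>t\<close> starts at \<open>N * m\<close> in the first run and at \<open>N + 1\<close> in
  the second.\<close>

definition select :: com where
  "select =
    While (Less (Const 0) (Var ''t''))
     (For ''j'' (Var ''m'') examine ;; ''t'' ::= Sub (Var ''t'') (Const 1))"

definition copy_edge :: com where
  "copy_edge =
    For ''l'' (Add size_expr (Const 1))
     (Write ''out'' (Var ''pos'') (entry (Var ''l'')) ;;
      ''pos'' ::= Add (Var ''pos'') (Const 1))"

definition emit :: com where
  "emit =
    (Write ''out'' (Const 1) (Read ''in'' (Const 1)) ;;
     ''pos'' ::= Const 2 ;;
     For ''j'' (Var ''m'') (Cond (Less (Const 0) (Read ''sel'' (Var ''j''))) copy_edge Skip) ;;
     Write ''out'' (Const 0) (Sub (Var ''pos'') (Const 1)))"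

lemma writes_simps [simp]:
  "writes place_unit = {''b'', ''l'', ''load''}"
  "writes lower_key = {''key''}"
  "writes examine = {''sel'', ''cnt''}"
  "writes copy_edge = {''l'', ''out'', ''pos''}"
  "writes offsets = {''m'', ''pos'', ''j'', ''start'', ''l''}"
  "writes root = {''s'', ''b'', ''j''}"
  "writes balance = {''r'', ''j'', ''b'', ''l'', ''load'', ''t''}"
  "writes load_keys = {''j'', ''key'', ''l''}"
  "writes size_keys = {''t'', ''j'', ''key''}"
  "writes select = {''j'', ''sel'', ''cnt'', ''t''}"
  by (auto simp: offsets_def place_unit_def examine_def lower_key_def copy_edge_def
       copy_edge_def root_def balance_def load_keys_def size_keys_def select_def)

definition prepare :: com where
  "prepare = (offsets ;; root ;; balance ;; load_keys)"

definition program :: com where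
  "program =
    (prepare ;;
     (''slack'' ::= Var ''s'' ;; select) ;;
     (size_keys ;; ''slack'' ::= Const 0 ;; select) ;;
     emit)"

text \<open>The value 100 is merely generous. Sums of two cells occur only in addresses and tests,
  never as values to be stored.\<close>

lemma gentle_program: "gentle 100 program"
proof -
  have 1: "s x i \<le> M + K" "s x i - d \<le> M + K" "d \<le> K \<Longrightarrow> s x i + d \<le> M + K"
    if "bounded s M" for s x i M K d
    using boundedD[OF that, of x i] by simp_all
  have 2: "Suc (s x i) \<le> M + 100" if "bounded s M" for s x i M
    using boundedD[OF that, of x i] by simp
  show ?thesis
    by (simp add: program_def prepare_def place_unit_def lower_key_def examine_def copy_edge_def
      offsets_def root_def balance_def load_keys_def size_keys_def select_def
      emit_def size_expr_def entry_def 1 2 trans_le_add1 trans_le_add2)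
qed

lemma wp_Seq_frame:
  assumes "wp B c1 P s" "\<And>s'. P s' \<Longrightarrow> (\<And>x. x \<notin> writes c1 \<Longrightarrow> s' x = s x) \<Longrightarrow> wp B c2 Q s'"
  shows "wp B (c1 ;; c2) Q s"
  by (rule wp_Seq, rule wp_frame[OF assms(1)], rule assms(2))

lemma wp_assign: "Q (s(x := (s x)(0 := aval a s))) \<Longrightarrow> wp B (x ::= a) Q s"
  using wp_Write[of Q s x "Const 0" a B] by simp

definition encode :: "nat list \<Rightarrow> nat list" where
  "encode xs = length xs # xs"

text \<open>This isolates the program proofs from list encodings: \<open>off j\<close> is the cell
  with the length of edge \<open>j\<close>. \<open>N\<close> is the length of the whole input list,
  which the machine provides in cell 0 and which dominates all relevant counts; \<open>B\<close>
  then covers even the \<open>N * m\<close> thresholds.\<close>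

locale union_input =
  fixes inp :: "nat \<Rightarrow> nat" and off :: "nat \<Rightarrow> nat" and es :: "nat list list" and N p B :: nat
  assumes inp_len: "inp 0 = N"
    and inp_p: "inp (Suc 0) = p"
    and inp_m: "inp (inp 2 + 3) = length es"
    and off_0: "off 0 = inp 2 + 4"
    and off_Suc: "j < length es \<Longrightarrow> off (Suc j) = Suc (off j + length (es ! j))"
    and inp_size: "j < length es \<Longrightarrow> inp (off j) = length (es ! j)"
    and inp_entry: "j < length es \<Longrightarrow> l < length (es ! j) \<Longrightarrow> inp (Suc (off j + l)) = es ! j ! l"
    and edges_le: "length es \<le> N"
    and size_less: "j < length es \<Longrightarrow> length (es ! j) < N"
    and bound: "N * N + N + 1 \<le> B"
begin

abbreviation m :: nat where "m \<equiv> length es"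

definition ready :: "state \<Rightarrow> bool" where
  "ready s \<longleftrightarrow> s ''in'' = inp \<and> s ''m'' 0 = m \<and> (\<forall>j<m. s ''start'' j = off j)"

lemma ready_upd [simp]:
  "x \<notin> {''in'', ''m'', ''start''} \<Longrightarrow> ready (s(x := v)) \<longleftrightarrow> ready s"
  by (auto simp: ready_def)

lemma readyI: "s ''in'' = inp \<Longrightarrow> s ''m'' 0 = m \<Longrightarrow> (\<And>j. j < m \<Longrightarrow> s ''start'' j = off j) \<Longrightarrow> ready s"
  by (simp add: ready_def)

lemma ready_simps [simp]:
  assumes "ready s"
  shows "s ''in'' = inp" "s ''m'' 0 = m" "j < m \<Longrightarrow> s ''start'' j = off j"
  using assms by (auto simp: ready_def)

lemma ready_cong:
  assumes "ready s" "s' ''in'' = s ''in''" "s' ''m'' = s ''m''" "s' ''start'' = s ''start''"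
  shows "ready s'"
  by (rule readyI) (use assms in simp_all)

lemma aval_size [simp]:
  "ready s \<Longrightarrow> s ''j'' 0 < m \<Longrightarrow> aval size_expr s = length (es ! (s ''j'' 0))"
  by (simp add: size_expr_def inp_size)

lemma aval_entry [simp]:
  "ready s \<Longrightarrow> s ''j'' 0 < m \<Longrightarrow> aval a s = Suc l \<Longrightarrow> l < length (es ! (s ''j'' 0)) \<Longrightarrow>
     aval (entry a) s = es ! (s ''j'' 0) ! l"
  by (simp add: entry_def inp_entry)

lemma B_bounds: "m \<le> B" "N \<le> B" "j < m \<Longrightarrow> Suc (length (es ! j)) \<le> B" "N * m \<le> B" "Suc N \<le> B"
proof -
  show "m \<le> B" "N \<le> B" "Suc N \<le> B" using edges_le bound by linarith+
  show "Suc (length (es ! j)) \<le> B" if "j < m" using size_less[OF that] bound by linarith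
  show "N * m \<le> B" using mult_le_mono2[OF edges_le, of N] bound by linarith
qed

section \<open>Correctness of the phases of the program\<close>

lemma wp_offsets:
  assumes s: "s ''in'' = inp"
  shows "wp B offsets ready s"
  unfolding offsets_def
proof (intro wp_Seq wp_assign,
    rule wp_For[where n = m and I = "\<lambda>j s. s ''in'' = inp \<and> s ''m'' 0 = m \<and>
      (\<forall>i<j. s ''start'' i = off i) \<and> s ''pos'' 0 = off j"])
  fix j s assume j: "j < m"
    and "s ''in'' = inp \<and> s ''m'' 0 = m \<and> (\<forall>i<j. s ''start'' i = off i) \<and> s ''pos'' 0 = off j"
    and sj: "s ''j'' 0 = j"
  then have s: "s ''in'' = inp" "s ''m'' 0 = m" "\<forall>i<j. s ''start'' i = off i" "s ''pos'' 0 = off j"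
    by auto
  show "wp B (Write ''start'' (Var ''j'') (Var ''pos'') ;;
       For ''l'' size_expr (''pos'' ::= Add (Var ''pos'') (Const 1)) ;;
       ''pos'' ::= Add (Var ''pos'') (Const 1))
     (\<lambda>s'. (s'(''j'' := (s' ''j'')(0 := Suc j))) ''in'' = inp \<and>
        (s'(''j'' := (s' ''j'')(0 := Suc j))) ''m'' 0 = m \<and>
        (\<forall>i<Suc j. (s'(''j'' := (s' ''j'')(0 := Suc j))) ''start'' i = off i) \<and>
        (s'(''j'' := (s' ''j'')(0 := Suc j))) ''pos'' 0 = off (Suc j)) s"
    apply (intro wp_Seq wp_Write)
    apply (rule wp_For[where n = "length (es ! j)" and I = "\<lambda>l s. s ''in'' = inp \<and> s ''m'' 0 = m \<and>
      (\<forall>i<Suc j. s ''start'' i = off i) \<and> s ''j'' 0 = j \<and> s ''pos'' 0 = off j + l"])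
    using s sj j B_bounds(3)[OF j]
    by (auto intro!: wp_assign simp: size_expr_def inp_size off_Suc less_Suc_eq)
qed (simp_all add: s inp_m off_0 B_bounds readyI)

lemma wp_root:
  assumes "ready s"
  shows "wp B root (\<lambda>s'. \<exists>b\<le>s' ''s'' 0. 2 * m = s' ''s'' 0 * s' ''s'' 0 + s' ''s'' 0 + 2 * b) s"
  unfolding root_def
proof (intro wp_Seq wp_assign,
    rule wp_For[where n = m and I = "\<lambda>i s. ready s \<and> s ''b'' 0 \<le> s ''s'' 0 \<and>
      2 * i = s ''s'' 0 * s ''s'' 0 + s ''s'' 0 + 2 * s ''b'' 0"])
qed (use assms B_bounds in \<open>auto intro!: wp_Cond wp_Seq wp_assign\<close>)

lemma wp_place_unit:
  assumes "ready s" and j: "j < m" "s ''j'' 0 = j" and "balanced es r j (s ''load'')"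
  shows "wp B place_unit (\<lambda>s'. balanced es r (Suc j) (s' ''load'')) s"
  unfolding place_unit_def
proof (rule wp_Cond, goal_cases)
  case 1
  then have ne: "0 < length (es ! j)" using assms by simp
  show ?case
  proof (intro wp_Seq wp_assign,
      rule wp_For[where n = "length (es ! j)" and I = "\<lambda>i s'. ready s' \<and> s' ''j'' 0 = j \<and>
        s' ''load'' = s ''load'' \<and> (\<exists>b<length (es ! j). s' ''b'' 0 = Suc b \<and>
          (\<forall>l<i. s ''load'' (es ! j ! b) \<le> s ''load'' (es ! j ! l)))"],
      goal_cases)
    case (5 i s1)
    then obtain b where s1: "ready s1" "s1 ''j'' 0 = j" "s1 ''load'' = s ''load''"
      and b: "b < length (es ! j)" "s1 ''b'' 0 = Suc b"
        "\<forall>l<i. s ''load'' (es ! j ! b) \<le> s ''load'' (es ! j ! l)"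
      and i: "i < length (es ! j)" "s1 ''l'' 0 = i"
      by auto
    have e: "aval (entry (Add (Var ''l'') (Const (Suc 0)))) s1 = es ! j ! i"
        "aval (entry (Var ''b'')) s1 = es ! j ! b"
      using s1 b i j by simp_all
    show ?case
    proof (intro wp_Cond wp_assign wp_Skip, goal_cases)
      case 1
      then have "s ''load'' (es ! j ! i) < s ''load'' (es ! j ! b)" by (simp add: e s1)
      then have "\<forall>l<Suc i. s ''load'' (es ! j ! i) \<le> s ''load'' (es ! j ! l)"
        using b(3) by (auto simp: less_Suc_eq)
      then show ?case using i(1) by (simp add: s1 i(2))
    next
      case 2
      then have "s ''load'' (es ! j ! b) \<le> s ''load'' (es ! j ! i)" by (simp add: e s1)
      then have "\<forall>l<Suc i. s ''load'' (es ! j ! b) \<le> s ''load'' (es ! j ! l)"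
        using b(3) by (auto simp: less_Suc_eq)
      then show ?case using b(1) by (simp add: s1 b(2))
    qed
  next
    case (6 s1)
    then obtain b where s1: "ready s1" "s1 ''j'' 0 = j" "s1 ''load'' = s ''load''"
      and b: "b < length (es ! j)" "s1 ''b'' 0 = Suc b"
        "\<forall>l<length (es ! j). s ''load'' (es ! j ! b) \<le> s ''load'' (es ! j ! l)"
      by auto
    have "aval (entry (Var ''b'')) s1 = es ! j ! b" using s1 b j by simp
    moreover have "balanced es r (Suc j) ((s ''load'')(es ! j ! b := Suc (s ''load'' (es ! j ! b))))"
      using b by (intro balanced_step assms) (auto simp: in_set_conv_nth)
    ultimately show ?case by (intro wp_Write) (simp add: s1)
  qed (use ne assms B_bounds(3)[OF j(1)] in auto)
next
  case 2
  then have "es ! j = []" using assms by simp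
  then show ?case using assms by (intro wp_Skip) (auto intro: balanced_empty)
qed

lemma wp_balance:
  assumes "ready s" "s ''load'' = (\<lambda>_. 0)" "s ''t'' 0 = 0"
  shows "wp B balance (\<lambda>s'. balanced es N 0 (s' ''load'') \<and> s' ''t'' 0 = N * m) s"
  unfolding balance_def
proof (rule wp_For[where n = N and I = "\<lambda>r s. ready s \<and> balanced es r 0 (s ''load'') \<and>
    s ''t'' 0 = r * m"], goal_cases)
  case (5 r s1)
  then have s1: "ready s1" "balanced es r 0 (s1 ''load'')" "s1 ''t'' 0 = r * m" by auto
  show ?case
  proof (rule wp_For[where n = m and I = "\<lambda>j s. ready s \<and> balanced es r j (s ''load'') \<and>
      s ''t'' 0 = r * m + j"], goal_cases)
    case (5 j s2)
    then have s2: "ready s2" "balanced es r j (s2 ''load'')" "s2 ''t'' 0 = r * m + j"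
      and j: "j < m" "s2 ''j'' 0 = j" by auto
    show ?case
    proof (rule wp_Seq_frame[OF wp_place_unit[OF s2(1) j s2(2)]], goal_cases)
      case (1 s3)
      have "ready s3" by (rule ready_cong[OF s2(1)]) (use 1 in simp_all)
      with 1 s2(3) show ?case by (intro wp_assign) simp
    qed
  qed (use s1 B_bounds in \<open>auto intro: balanced_round\<close>)
qed (use assms B_bounds in \<open>auto simp: inp_len balanced_0\<close>)

lemma wp_lower_key:
  assumes "ready s" "j < m" "s ''j'' 0 = j" "l < length (es ! j)" "s ''l'' 0 = l"
  shows "wp B lower_key (\<lambda>s'. s' ''key'' =
    (s ''key'')(j := min (s ''key'' j) (s ''load'' (es ! j ! l)))) s"
proof -
  have "aval (entry (Add (Var ''l'') (Const (Suc 0)))) s = es ! j ! l" using assms by simp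
  then show ?thesis unfolding lower_key_def
    using assms(3) by (intro wp_Cond wp_Write wp_Skip) (auto simp: min_def)
qed

text \<open>The key is described through its lower bounds, so that the capped minimum needs no
  special case for an empty edge.\<close>

lemma wp_load_keys:
  assumes "ready s"
  shows "wp B load_keys (\<lambda>s'. \<forall>j<m. \<forall>A. A \<le> s' ''key'' j \<longleftrightarrow>
    A \<le> s ''t'' 0 \<and> (\<forall>v\<in>set (es ! j). A \<le> s ''load'' v)) s"
  unfolding load_keys_def
proof (rule wp_For[where n = m and I = "\<lambda>j s'. ready s' \<and> s' ''t'' = s ''t'' \<and> s' ''load'' = s ''load'' \<and>
    (\<forall>i<j. \<forall>A. A \<le> s' ''key'' i \<longleftrightarrow> A \<le> s ''t'' 0 \<and> (\<forall>v\<in>set (es ! i). A \<le> s ''load'' v))"],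
    goal_cases)
  case (5 j s1)
  note I = 5(2) and j = 5(1,3)
  show ?case
  proof (intro wp_Seq wp_Write, rule wp_For[where n = "length (es ! j)" and
      I = "\<lambda>l s'. ready s' \<and> s' ''t'' = s ''t'' \<and> s' ''load'' = s ''load'' \<and> s' ''j'' 0 = j \<and>
        (\<forall>i<j. \<forall>A. A \<le> s' ''key'' i \<longleftrightarrow> A \<le> s ''t'' 0 \<and> (\<forall>v\<in>set (es ! i). A \<le> s ''load'' v)) \<and>
        (\<forall>A. A \<le> s' ''key'' j \<longleftrightarrow> A \<le> s ''t'' 0 \<and> (\<forall>i<l. A \<le> s ''load'' (es ! j ! i)))"],
      goal_cases)
    case (5 l s2)
    then have s2: "ready s2" "s2 ''j'' 0 = j" "s2 ''t'' = s ''t''" "s2 ''load'' = s ''load''"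
      and l: "l < length (es ! j)" "s2 ''l'' 0 = l"
      by auto
    show ?case
    proof (rule wp_frame[OF wp_lower_key[OF s2(1) j(1) s2(2) l]], goal_cases)
      case (1 s3)
      have "ready s3" by (rule ready_cong[OF s2(1)]) (use 1 in simp_all)
      moreover have "s3 ''t'' = s ''t''" "s3 ''load'' = s ''load''" "s3 ''j'' 0 = j"
        using 1 s2 by simp_all
      ultimately show ?case using 1(1) 5(2) s2(4) by (auto simp: less_Suc_eq)
    qed
  qed (use I j B_bounds(3)[OF j(1)] in \<open>auto simp: less_Suc_eq all_set_conv_all_nth\<close>)
qed (use assms B_bounds in auto)

lemma wp_size_keys:
  assumes "ready s"
  shows "wp B size_keys (\<lambda>s'. s' ''t'' 0 = Suc N \<and> (\<forall>j<m. s' ''key'' j = Suc N - length (es ! j))) s"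
  unfolding size_keys_def
proof (intro wp_Seq wp_assign, rule wp_For[where n = m and I = "\<lambda>j s. ready s \<and> s ''t'' 0 = Suc N \<and>
    (\<forall>i<j. s ''key'' i = Suc N - length (es ! i))"])
qed (use assms B_bounds in \<open>auto intro!: wp_Write simp: inp_len less_Suc_eq\<close>)

definition selected :: "state \<Rightarrow> nat set" where
  "selected s = {j. j < m \<and> s ''sel'' j \<noteq> 0}"

text \<open>Keys at most \<open>t\<close> make the entry state a valid start, no index being above
  the first threshold. Allowing any initial selection, with \<open>cnt\<close> equal to its size,
  lets the second run continue from the result of the first.\<close>

lemma wp_select:
  assumes "ready s" "s ''cnt'' 0 = card (selected s)" "s ''t'' 0 \<le> B"
    and "\<And>j. j < m \<Longrightarrow> s ''key'' j \<le> s ''t'' 0"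
  shows "wp B select (\<lambda>s'. greedy m (p - s ''slack'' 0) (s ''key'') (selected s) 0 0 (selected s') \<and>
    s' ''cnt'' 0 = card (selected s')) s"
  unfolding select_def
proof (rule wp_While[where n = "s ''t'' 0" and I = "\<lambda>i s'. ready s' \<and>
    s' ''key'' = s ''key'' \<and> s' ''slack'' = s ''slack'' \<and> s' ''t'' 0 = s ''t'' 0 - i \<and>
    s' ''cnt'' 0 = card (selected s') \<and>
    greedy m (p - s ''slack'' 0) (s ''key'') (selected s) (s ''t'' 0 - i) 0 (selected s')"], goal_cases)
  case 2
  have "greedy m (p - s ''slack'' 0) (s ''key'') (selected s) (s ''t'' 0) 0 (selected s)"
    by (rule greedy_start) (use assms(4) in \<open>auto simp: selected_def\<close>)
  with assms show ?case by simp
next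
  case (3 i s1)
  define t where "t = s ''t'' 0 - Suc i"
  have t: "s ''t'' 0 - i = Suc t" using 3(1) by (simp add: t_def)
  let ?g = "greedy m (p - s ''slack'' 0) (s ''key'') (selected s)"
  let ?I = "\<lambda>j s'. ready s' \<and> s' ''key'' = s ''key'' \<and> s' ''slack'' = s ''slack'' \<and> s' ''t'' 0 = Suc t \<and>
    s' ''cnt'' 0 = card (selected s') \<and> ?g (Suc t) j (selected s')"
  have I0: "?I 0 s1" using 3(2) t by simp
  have "wp B (For ''j'' (Var ''m'') examine) (?I m) s1"
  proof (rule wp_For[where n = m and I = ?I], goal_cases)
    case (5 j s2)
    then have s2: "?I j s2" and j: "j < m" "s2 ''j'' 0 = j" by auto
    have upd: "selected (s2(''j'' := v)) = selected s2" for s2 v by (simp add: selected_def)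
    have "wp B examine (?I (Suc j)) s2"
      unfolding examine_def
    proof (intro wp_Cond wp_Seq wp_Write wp_assign wp_Skip, goal_cases)
      case 1
      then have c: "card (selected s2) < p - s ''slack'' 0" "j \<notin> selected s2" "Suc t \<le> s ''key'' j"
        using s2 j by (auto simp: inp_p selected_def)
      let ?s = "s2(''sel'' := (s2 ''sel'')(j := 1), ''cnt'' := (s2 ''cnt'')(0 := Suc (s2 ''cnt'' 0)))"
      have sel: "selected ?s = insert j (selected s2)" using j by (auto simp: selected_def)
      have "finite (selected s2)" by (simp add: selected_def)
      then have "?I (Suc j) ?s"
        using s2 c greedy_insert[where key = "s ''key''" and t = "Suc t", OF _ j(1) c, of "selected s"] unfolding sel by simp
      then show ?case using j by simp
    next
      case 2
      then have "\<not> (card (selected s2) < p - s ''slack'' 0 \<and> j \<notin> selected s2 \<and> Suc t \<le> s ''key'' j)"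
        using s2 j by (auto simp: inp_p selected_def)
      with s2 show ?case by (auto intro: greedy_skip)
    qed
    then show ?case by (rule wp_mono) (simp add: upd)
  qed (use I0 B_bounds in \<open>auto simp: selected_def\<close>)
  then have "wp B (For ''j'' (Var ''m'') examine ;; ''t'' ::= Sub (Var ''t'') (Const 1))
     (\<lambda>s'. ready s' \<and> s' ''key'' = s ''key'' \<and> s' ''slack'' = s ''slack'' \<and> s' ''t'' 0 = t \<and>
        s' ''cnt'' 0 = card (selected s') \<and> ?g t 0 (selected s')) s1"
    by (intro wp_Seq, elim wp_mono, intro wp_assign) (auto simp: selected_def dest: greedy_lower)
  then show ?case using 3 by (simp add: t t_def)
qed (use assms in auto)

text \<open>Cell 0 of \<open>out\<close> is left open, since the length of the output is known only
  at the end.\<close>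

definition written :: "state \<Rightarrow> nat list \<Rightarrow> bool" where
  "written s ys \<longleftrightarrow> s ''pos'' 0 = Suc (length ys) \<and> (\<forall>i<length ys. s ''out'' (Suc i) = ys ! i)"

lemma written_upd [simp]: "x \<notin> {''pos'', ''out''} \<Longrightarrow> written (s(x := v)) ys \<longleftrightarrow> written s ys"
  by (auto simp: written_def)

lemma result_written:
  assumes "written s ys"
  shows "result (s(''out'' := (s ''out'')(0 := length ys))) = ys"
  using assms by (intro nth_equalityI) (simp_all add: result_def written_def del: upt_Suc)

lemma wp_append:
  assumes "written s ys"
    and "\<And>s'. written s' (ys @ [aval a s]) \<Longrightarrow> (\<And>x. x \<notin> {''pos'', ''out''} \<Longrightarrow> s' x = s x) \<Longrightarrow> Q s'"
  shows "wp B (Write ''out'' (Var ''pos'') a ;; ''pos'' ::= Add (Var ''pos'') (Const 1)) Q s"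
  by (intro wp_Seq wp_Write wp_assign assms(2))
    (use assms(1) in \<open>auto simp: written_def nth_append less_Suc_eq\<close>)

lemma wp_emit:
  assumes "ready s"
  shows "wp B emit (\<lambda>s'. result s' =
    p # concat (map encode (map ((!) es) (filter (\<lambda>j. s ''sel'' j \<noteq> 0) [0..<m])))) s"
proof -
  let ?ys = "\<lambda>j. p # concat (map encode (map ((!) es) (filter (\<lambda>j. s ''sel'' j \<noteq> 0) [0..<j])))"
  let ?I = "\<lambda>j s'. ready s' \<and> s' ''sel'' = s ''sel'' \<and> written s' (?ys j)"
  have loop: "wp B (For ''j'' (Var ''m'')
      (Cond (Less (Const 0) (Read ''sel'' (Var ''j'')))
        copy_edge Skip)) (?I m) s1" if s1: "?I 0 s1" for s1
  proof (rule wp_For[where n = m and I = ?I], goal_cases)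
    case (5 j s2)
    then have s2: "?I j s2" and j: "j < m" "s2 ''j'' 0 = j" by auto
    have "wp B (Cond (Less (Const 0) (Read ''sel'' (Var ''j'')))
        copy_edge Skip) (?I (Suc j)) s2"
    proof (rule wp_Cond)
      assume "bval (Less (Const 0) (Read ''sel'' (Var ''j''))) s2"
      then have sel: "s ''sel'' j \<noteq> 0" using s2 j by simp
      let ?J = "\<lambda>l s'. ready s' \<and> s' ''sel'' = s ''sel'' \<and> s' ''j'' 0 = j \<and>
        written s' (?ys j @ take l (encode (es ! j)))"
      show "wp B copy_edge (?I (Suc j)) s2"
        unfolding copy_edge_def
      proof (rule wp_For[where n = "Suc (length (es ! j))" and I = ?J], goal_cases)
        case (5 l s3)
        then have s3: "?J l s3" and l: "l < Suc (length (es ! j))" "s3 ''l'' 0 = l" by auto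
        have "aval (entry (Var ''l'')) s3 = encode (es ! j) ! l"
        proof (cases l)
          case 0
          then show ?thesis using s3 j l
            by (simp add: entry_def encode_def inp_size)
        next
          case (Suc l')
          then show ?thesis using s3 j l by (simp add: encode_def)
        qed
        then have ys: "?ys j @ take (Suc l) (encode (es ! j)) =
            (?ys j @ take l (encode (es ! j))) @ [aval (entry (Var ''l'')) s3]"
          using l by (simp add: take_Suc_conv_app_nth encode_def del: take_Suc_Cons)
        show ?case
        proof (rule wp_append)
          show "written s3 (?ys j @ take l (encode (es ! j)))" using s3 by blast
        next
          fix s' assume w: "written s' ((?ys j @ take l (encode (es ! j))) @ [aval (entry (Var ''l'')) s3])"
            and eq: "\<And>x. x \<notin> {''pos'', ''out''} \<Longrightarrow> s' x = s3 x"
          have "ready s'" by (rule readyI) (use s3 in \<open>simp_all add: eq\<close>)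
          with w s3 show "?J (Suc l) (s'(''l'' := (s' ''l'')(0 := Suc l)))"
            unfolding ys by (simp add: eq)
        qed
      qed (use s2 j sel B_bounds(3)[OF j(1)] in \<open>auto simp: encode_def\<close>)
    next
      assume "\<not> bval (Less (Const 0) (Read ''sel'' (Var ''j''))) s2"
      then show "wp B Skip (?I (Suc j)) s2" using s2 j by (intro wp_Skip) simp
    qed
    then show ?case by (rule wp_mono) simp
  qed (use s1 B_bounds in auto)
  show ?thesis
    unfolding emit_def
  proof (intro wp_Seq wp_Write wp_assign, rule wp_mono[OF loop], goal_cases)
    case 1
    then show ?case using assms by (simp add: written_def inp_p)
  next
    case (2 s')
    then have "written s' (?ys m)" by simp
    then have "result (s'(''out'' := (s' ''out'')(0 := length (?ys m)))) = ?ys m"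
      by (rule result_written)
    moreover have "s' ''pos'' 0 = Suc (length (?ys m))"
      using 2 unfolding written_def by blast
    ultimately show ?case by (intro wp_Write) simp
  qed
qed

lemma selected_cong: "s' ''sel'' = s ''sel'' \<Longrightarrow> selected s' = selected s"
  by (simp add: selected_def)

lemma wp_prepare:
  assumes "s ''in'' = inp" "s ''load'' = (\<lambda>_. 0)" "s ''t'' = (\<lambda>_. 0)"
  shows "wp B prepare (\<lambda>s'. ready s' \<and> s' ''t'' 0 = N * m \<and>
    (\<exists>b\<le>s' ''s'' 0. 2 * m = s' ''s'' 0 * s' ''s'' 0 + s' ''s'' 0 + 2 * b) \<and>
    balanced es N 0 (s' ''load'') \<and>
    (\<forall>j<m. \<forall>A. A \<le> s' ''key'' j \<longleftrightarrow> A \<le> N * m \<and> (\<forall>v\<in>set (es ! j). A \<le> s' ''load'' v))) s"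
  unfolding prepare_def
proof (rule wp_Seq_frame, rule wp_offsets, rule assms(1), goal_cases)
  case (1 s1)
  note s1 = this
  show ?case
  proof (rule wp_Seq_frame[OF wp_root[OF s1(1)]], goal_cases)
    case (1 s2)
    have r2: "ready s2" by (rule ready_cong[OF s1(1)]) (use 1 in simp_all)
    note s2 = 1
    show ?case
    proof (rule wp_Seq_frame[OF wp_balance[OF r2]], goal_cases)
      case (3 s3)
      have r3: "ready s3" by (rule ready_cong[OF r2]) (use 3 in simp_all)
      note s3 = 3
      show ?case
      proof (rule wp_frame[OF wp_load_keys[OF r3]], goal_cases)
        case (1 s4)
        have "ready s4" by (rule ready_cong[OF r3]) (use 1 in simp_all)
        then show ?case using 1 s2 s3 by simp
      qed
    qed (use assms s1 s2 in simp_all)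
  qed
qed

text \<open>\<open>J\<close> is an arbitrary competitor that the program never sees; it and
  \<open>k\<close> enter only through \<open>selection_bound\<close>. The witness for
  \<open>r\<close> is the final value of \<open>s\<close>.\<close>

lemma wp_program:
  assumes init: "s ''in'' = inp" "\<And>x. x \<noteq> ''in'' \<Longrightarrow> s x = (\<lambda>_. 0)"
    and distinct: "distinct (map set es)" "\<And>j. j < m \<Longrightarrow> distinct (es ! j)"
    and opt: "J \<subseteq> {..<m}" "card J = p" "card (verts es J) = k" "k \<le> N"
  shows "wp B program (\<lambda>s'. \<exists>r I. r * r \<le> 2 * m \<and> I \<subseteq> {..<m} \<and> card I = p \<and>
    card (verts es I) \<le> 5 * r * k \<and>
    result s' = p # concat (map encode (map ((!) es) (filter (\<lambda>j. j \<in> I) [0..<m])))) s"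
  unfolding program_def
proof (rule wp_Seq_frame[OF wp_prepare], goal_cases)
  case (4 s1)
  then obtain b where s1: "ready s1" "s1 ''t'' 0 = N * m" "balanced es N 0 (s1 ''load'')"
    and b: "b \<le> s1 ''s'' 0" "2 * m = s1 ''s'' 0 * s1 ''s'' 0 + s1 ''s'' 0 + 2 * b"
    and key: "\<And>j A. j < m \<Longrightarrow> A \<le> s1 ''key'' j \<longleftrightarrow> A \<le> N * m \<and> (\<forall>v\<in>set (es ! j). A \<le> s1 ''load'' v)"
    by auto
  have fr: "s1 ''sel'' = (\<lambda>_. 0)" "s1 ''cnt'' = (\<lambda>_. 0)"
    using 4 init(2) by (simp_all add: prepare_def)
  then have sel1: "selected s1 = {}" by (simp add: selected_def)
  let ?r = "s1 ''s'' 0"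
  have "wp B (''slack'' ::= Var ''s'' ;; select)
    (\<lambda>s'. greedy m (p - ?r) (s1 ''key'') {} 0 0 (selected s') \<and> s' ''cnt'' 0 = card (selected s')) s1"
  proof (intro wp_Seq wp_assign, rule wp_mono[OF wp_select], goal_cases)
    case (5 s2)
    moreover have "selected (s1(''slack'' := v)) = {}" for v
      using sel1 by (simp add: selected_def)
    ultimately show ?case by simp
  \<comment> \<open>Putting \<open>A\<close> equal to the key itself in its characterisation shows
    that no key exceeds \<open>N * m\<close>, the starting threshold.\<close>
  qed (use s1 B_bounds fr key[THEN iffD1, OF _ order_refl] in \<open>simp_all add: selected_def\<close>)
  then show ?case
  proof (rule wp_Seq_frame, goal_cases)
    case (1 s2)
    have r2: "ready s2" by (rule ready_cong[OF s1(1)]) (use 1 in simp_all)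
    note s2 = 1
    have "wp B (size_keys ;; ''slack'' ::= Const 0 ;; select)
      (\<lambda>s'. \<exists>key2. (\<forall>j<m. key2 j = Suc N - length (es ! j)) \<and>
        greedy m p key2 (selected s2) 0 0 (selected s')) s2"
    proof (rule wp_Seq_frame[OF wp_size_keys[OF r2]], goal_cases)
      case (1 s3)
      have r3: "ready s3" by (rule ready_cong[OF r2]) (use 1 in simp_all)
      have sel3: "selected (s3(''slack'' := v)) = selected s2" for v
        by (rule selected_cong) (use 1 in simp)
      show ?case
      proof (intro wp_Seq wp_assign, rule wp_mono[OF wp_select], goal_cases)
        case (5 s4)
        with 1 show ?case by (intro exI[of _ "s3 ''key''"]) (simp add: sel3)
      qed (use 1 r3 s2 B_bounds in \<open>simp_all add: sel3\<close>)
    qed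
    then show ?case
    proof (rule wp_Seq_frame, goal_cases)
      case (1 s3)
      have r3: "ready s3" by (rule ready_cong[OF r2]) (use 1 in simp_all)
      from 1 obtain key2 where key2: "\<And>j. j < m \<Longrightarrow> key2 j = Suc N - length (es ! j)"
        "greedy m p key2 (selected s2) 0 0 (selected s3)" by auto
      have len: "length (es ! j) \<le> N" if "j < m" for j using size_less[OF that] by simp
      have key1: "A \<le> s1 ''key'' j \<longleftrightarrow> (\<forall>v\<in>set (es ! j). A \<le> s1 ''load'' v)"
        if "j < m" "A \<le> N * m" for j A
        using key[OF that(1)] that(2) by simp
      have J1: "greedy m (p - ?r) (s1 ''key'') {} 0 0 (selected s2)" using s2 by simp
      note * = selection_bound[where f = "s1 ''load''" and ?key1.0 = "s1 ''key''" and ?key2.0 = key2,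
          OF distinct len s1(3) b(2,1) opt key1 key2(1) J1 key2(2)]
      have "selected s3 \<subseteq> {..<m}" by (auto simp: selected_def)
      moreover have "filter (\<lambda>j. s3 ''sel'' j \<noteq> 0) [0..<m] = filter (\<lambda>j. j \<in> selected s3) [0..<m]"
        by (rule filter_cong) (auto simp: selected_def)
      moreover have "?r * ?r \<le> 2 * m" using b by simp
      ultimately show ?case
        using * by (intro wp_mono[OF wp_emit[OF r3]] exI[of _ ?r] exI[of _ "selected s3"]) simp
    qed
  qed
qed (use init in simp_all)

end

section \<open>Encodings\<close>

lemma list_all2_encodes_setD:
  "list_all2 encodes_set As wss \<Longrightarrow>
   \<exists>es. As = map set es \<and> wss = map encode es \<and> (\<forall>xs\<in>set es. distinct xs)"
proof (induction rule: list_all2_induct)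
  case Nil
  then show ?case by simp
next
  case (Cons A As ws wss)
  then obtain es xs where "As = map set es" "wss = map encode es" "\<forall>xs\<in>set es. distinct xs"
    "A = set xs" "ws = encode xs" "distinct xs"
    by (auto simp: encodes_set_def encode_def)
  then show ?case by (intro exI[of _ "xs # es"]) simp
qed

lemma encodes_edgesI:
  assumes "\<forall>xs\<in>set es. distinct xs" "distinct (map set es)"
  shows "encodes_edges (set (map set es)) (length es # concat (map encode es))"
proof -
  have "list_all2 encodes_set (map set es) (map encode es)"
    using assms(1) by (auto simp: list_all2_conv_all_nth encodes_set_def encode_def)
  then show ?thesis using assms(2) unfolding encodes_edges_def
    by (intro exI[of _ "map set es"] exI[of _ "map encode es"]) simp
qed

lemma encodes_instanceE:
  assumes "encodes_instance V E p ws"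
  obtains vs es where "V = set vs" "distinct vs" "E = set (map set es)" "distinct (map set es)"
    "\<forall>xs\<in>set es. distinct xs" "ws = p # length vs # vs @ length es # concat (map encode es)"
proof -
  from assms obtain vs As wss where "V = set vs" "distinct vs" "distinct As" "set As = E"
    "list_all2 encodes_set As wss" "ws = p # length vs # vs @ length As # concat wss"
    by (auto simp: encodes_instance_def encodes_set_def encodes_edges_def)
  with list_all2_encodes_setD[of As wss] that show ?thesis by fastforce
qed

text \<open>The summand 4 counts the list length in cell 0, \<open>p\<close>, and the numbers of
  vertices and of edges. Every access to edge \<open>j\<close> is read off by cutting the encoding
  just before and after that edge.\<close>

lemma union_input_load:
  assumes ws: "ws = p # length vs # vs @ length es # concat (map encode es)"
    and B: "length ws * length ws + length ws + 1 \<le> B"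
  shows "union_input (load ws ''in'') (\<lambda>j. 4 + length vs + length (concat (map encode (take j es))))
    es (length ws) p B"
proof -
  let ?in = "load ws ''in''"
  let ?pre = "\<lambda>j. concat (map encode (take j es))"
  have split: "concat (map encode es) = ?pre j @ encode (es ! j) @ concat (map encode (drop (Suc j) es))"
    if "j < length es" for j
    by (subst id_take_nth_drop[OF that]) simp
  have nth: "?in (4 + length vs + length (?pre j) + l) = encode (es ! j) ! l"
    if "j < length es" "l \<le> length (es ! j)" for j l
  proof -
    let ?xs = "length ws # p # length vs # vs @ length es # ?pre j"
    let ?rest = "concat (map encode (drop (Suc j) es))"
    have ws': "length ws # ws = ?xs @ encode (es ! j) @ ?rest"
      by (subst (2) ws) (simp add: split[OF that(1)])
    have "?in (length ?xs + l) = (length ws # ws) ! (length ?xs + l)"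
      using that(2) arg_cong[OF ws', of length] by (simp add: load_def encode_def)
    also have "\<dots> = (encode (es ! j) @ ?rest) ! l"
      unfolding ws' by (rule nth_append_length_plus)
    also have "\<dots> = encode (es ! j) ! l"
      using that(2) by (subst nth_append) (simp add: encode_def)
    also have "length ?xs = 4 + length vs + length (?pre j)" by simp
    finally show ?thesis .
  qed
  have "length es \<le> length (concat (map encode es))"
    by (induction es) (simp_all add: encode_def)
  then have le: "length es \<le> length ws" by (simp add: ws)
  show ?thesis
  proof
    show "?in 0 = length ws" "?in (Suc 0) = p" by (simp_all add: load_def ws)
    show "?in (?in 2 + 3) = length es"
      by (simp add: load_def ws eval_nat_numeral nth_append)
    show "4 + length vs + length (?pre 0) = ?in 2 + 4"
      by (simp add: load_def ws eval_nat_numeral)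
    show "length es \<le> length ws" by (rule le)
    show "length ws * length ws + length ws + 1 \<le> B" by (rule B)
  next
    fix j assume j: "j < length es"
    show "4 + length vs + length (?pre (Suc j)) = Suc (4 + length vs + length (?pre j) + length (es ! j))"
      using j by (simp add: take_Suc_conv_app_nth encode_def)
    show "?in (4 + length vs + length (?pre j)) = length (es ! j)"
      using nth[OF j, of 0] by (simp add: encode_def)
    show "length (es ! j) < length ws"
      unfolding ws split[OF j] by (simp add: encode_def)
    show "?in (Suc (4 + length vs + length (?pre j) + l)) = es ! j ! l" if "l < length (es ! j)" for l
      using nth[OF j, of "Suc l"] that by (simp add: encode_def)
  qed
qed

section \<open>Running time and conclusion\<close>

text \<open>\<open>T\<close> bounds the steps, with loop bound \<open>x * x + x + 1\<close> for
  inputs of bit size \<open>x\<close>. The other factor is the price per step from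
  \<open>exec_of_steps\<close> with \<open>K = 100\<close>.\<close>

definition time_poly :: "nat poly" where
  "time_poly = (let T = pcompose (step_poly program) [:1, 1, 1:]
    in T * smult 101 ([:len 100 + 4, 1:] + smult 100 T))"

lemma length_le_bit_size: "length ws \<le> bit_size ws"
proof (induction ws)
  case (Cons w ws)
  with len_pos[of w] show ?case by (simp add: bit_size_def)
qed simp

text \<open>The largest input number \<open>M\<close> may be exponential in \<open>x\<close>, but
  its bit length is either a summand of \<open>x\<close> or that of a list length at most
  \<open>x\<close>. The price per step depends on \<open>M\<close> only through this bit
  length.\<close>

lemma exec_time:
  fixes ws :: "nat list"
  defines "x \<equiv> bit_size ws"
  assumes "wp (x * x + x + 1) program Q (load ws)"
  shows "\<exists>t s. exec program (load ws) t s \<and> t \<le> poly time_poly x \<and> Q s"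
proof -
  let ?T = "poly (pcompose (step_poly program) [:1, 1, 1:]) x"
  from assms(2) obtain n s where n: "n \<le> ?T" "steps program (load ws) n s" "Q s"
    unfolding wp_def by (auto simp: poly_pcompose algebra_simps)
  define M where "M = Max (insert (length ws) (set ws))"
  have M: "w \<le> M" if "w \<in> insert (length ws) (set ws)" for w
    unfolding M_def using that by (intro Max_ge) auto
  have "bounded (load ws) M"
    using M by (auto simp: bounded_def load_def nth_Cons')
  from exec_of_steps[OF n(2) gentle_program this order_refl] obtain t where
    t: "exec program (load ws) t s" "t \<le> n * (Suc 100 * len (100 * Suc (M + 100 * n)))" by auto
  have lx: "length ws \<le> x" unfolding x_def by (rule length_le_bit_size)
  have "len M \<le> Suc x"
  proof -
    have "M \<in> insert (length ws) (set ws)" unfolding M_def by (intro Max_in) auto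
    then show ?thesis
    proof
      assume "M = length ws"
      then show ?thesis using len_le[of M] lx by simp
    next
      assume "M \<in> set ws"
      then have "len M \<le> x"
        unfolding x_def bit_size_def by (intro member_le_sum_list) auto
      then show ?thesis by simp
    qed
  qed
  then have "len (Suc M) \<le> Suc (Suc x)" using len_Suc[of M] by simp
  moreover have "len (Suc (100 * n)) \<le> Suc (Suc (100 * n))" by (rule len_le)
  \<comment> \<open>The sum is estimated by a product so that bit lengths add: \<open>M\<close>
    contributes about \<open>x\<close>, and the growth during the run a term polynomial in
    \<open>x\<close>.\<close>
  moreover have "len (100 * Suc (M + 100 * n)) \<le> len 100 + len (Suc M * Suc (100 * n))"
    by (rule order_trans[OF len_mono len_mult]) simp
  moreover have "len (Suc M * Suc (100 * n)) \<le> len (Suc M) + len (Suc (100 * n))"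
    by (rule len_mult)
  ultimately have "len (100 * Suc (M + 100 * n)) \<le> len 100 + 4 + x + 100 * ?T"
    using n(1) by linarith
  then have "n * (Suc 100 * len (100 * Suc (M + 100 * n))) \<le>
      ?T * (101 * (len 100 + 4 + x + 100 * ?T))"
    using n(1) by (intro mult_mono) auto
  also have "\<dots> = poly time_poly x" by (simp add: time_poly_def Let_def)
  finally show ?thesis using t n(3) by (meson le_trans)
qed

lemma min_union_attained:
  assumes "finite E" "p \<le> card E"
  obtains E0 where "E0 \<subseteq> E" "card E0 = p" "card (\<Union>E0) = min_union E p"
proof -
  let ?S = "{card (\<Union>E') | E'. E' \<subseteq> E \<and> card E' = p}"
  have "?S \<subseteq> (\<lambda>E'. card (\<Union>E')) ` Pow E" by auto
  then have "finite ?S" using assms(1) by (simp add: finite_subset)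
  moreover have "?S \<noteq> {}"
  proof -
    obtain T where "T \<subseteq> E" "card T = p" using obtain_subset_with_card_n[OF assms(2)] by metis
    then show ?thesis by auto
  qed
  ultimately have "min_union E p \<in> ?S" unfolding min_union_def by (rule Min_in)
  then show ?thesis using that by auto
qed

theorem theorem1:
  "\<exists>(c :: com) (q :: nat poly) (C :: real).
     \<forall>(V :: nat set) (E :: nat set set) (p :: nat) (ws :: nat list).
       hypergraph V E \<and> p \<le> card E \<and> encodes_instance V E p ws \<longrightarrow>
       (\<exists>t ws' E'. computes c ws t ws' \<and> t \<le> poly q (bit_size ws) \<and>
          encodes_edges E' ws' \<and> E' \<subseteq> E \<and> card E' = p \<and>
          real (card (\<Union>E')) \<le> C * sqrt (real (card E)) * real (min_union E p))"
proof (rule exI[of _ program], rule exI[of _ time_poly], rule exI[of _ 10],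
    intro allI impI, elim conjE)
  fix V E p ws
  assume hyp: "hypergraph V E" and p: "p \<le> card E" and enc: "encodes_instance V E p ws"
  from enc obtain vs es where V: "V = set vs" "distinct vs" and E: "E = set (map set es)"
    and dist: "distinct (map set es)" "\<forall>xs\<in>set es. distinct xs"
    and ws: "ws = p # length vs # vs @ length es # concat (map encode es)"
    by (rule encodes_instanceE)
  let ?x = "bit_size ws" and ?m = "length es"
  have cE: "card E = ?m" using distinct_card[OF dist(1)] E by simp
  have inj: "inj_on (\<lambda>j. set (es ! j)) {..<?m}"
    using dist(1) by (auto simp: inj_on_def distinct_conv_nth)
  obtain E0 where E0: "E0 \<subseteq> E" "card E0 = p" "card (\<Union>E0) = min_union E p"
    using min_union_attained[OF _ p] E by auto
  \<comment> \<open>The optimum is transported to indices in the given listing; this preserves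
    cardinality because the listed edges are pairwise distinct as sets.\<close>
  define J where "J = {j. j < ?m \<and> set (es ! j) \<in> E0}"
  have J: "J \<subseteq> {..<?m}" by (auto simp: J_def)
  have JE0: "(\<lambda>j. set (es ! j)) ` J = E0"
  proof
    show "E0 \<subseteq> (\<lambda>j. set (es ! j)) ` J"
    proof
      fix e assume e: "e \<in> E0"
      then obtain xs where "xs \<in> set es" "e = set xs"
        using E0(1) unfolding E by auto
      then obtain j where "j < ?m" "e = set (es ! j)"
        by (auto simp: in_set_conv_nth)
      with e show "e \<in> (\<lambda>j. set (es ! j)) ` J" by (auto simp: J_def)
    qed
  qed (auto simp: J_def)
  have cJ: "card J = p" using card_image[OF inj_on_subset[OF inj J]] JE0 E0(2) by simp
  have vJ: "card (verts es J) = min_union E p"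
    unfolding verts_def JE0 using E0(3) by simp
  have lx: "length ws \<le> ?x" by (rule length_le_bit_size)
  have "\<Union>E0 \<subseteq> V" using E0(1) hyp by (auto simp: hypergraph_def)
  then have "card (\<Union>E0) \<le> card V" using V by (intro card_mono) auto
  then have kN: "min_union E p \<le> length ws"
    using E0(3) V distinct_card[OF V(2)] by (simp add: ws)
  have B: "length ws * length ws + length ws + 1 \<le> ?x * ?x + ?x + 1"
    using lx by (intro add_mono mult_mono) auto
  interpret union_input "load ws ''in''" "\<lambda>j. 4 + length vs + length (concat (map encode (take j es)))"
    es "length ws" p "?x * ?x + ?x + 1"
    by (rule union_input_load[OF ws B])
  have "wp (?x * ?x + ?x + 1) program (\<lambda>s'. \<exists>r I. r * r \<le> 2 * ?m \<and> I \<subseteq> {..<?m} \<and> card I = p \<and>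
    card (verts es I) \<le> 5 * r * min_union E p \<and>
    result s' = p # concat (map encode (map ((!) es) (filter (\<lambda>j. j \<in> I) [0..<?m])))) (load ws)"
    by (rule wp_program[OF _ _ dist(1) _ J cJ vJ kN]) (use dist(2) in \<open>auto simp: load_def\<close>)
  from exec_time[OF this] obtain t s r I where
    t: "exec program (load ws) t s" "t \<le> poly time_poly ?x"
    and r: "r * r \<le> 2 * ?m" and I: "I \<subseteq> {..<?m}" "card I = p"
    and small: "card (verts es I) \<le> 5 * r * min_union E p"
    and res: "result s = p # concat (map encode (map ((!) es) (filter (\<lambda>j. j \<in> I) [0..<?m])))"
    by auto
  define js where "js = filter (\<lambda>j. j \<in> I) [0..<?m]"
  have js: "set js = I" "distinct js" using I(1) by (auto simp: js_def)
  let ?es' = "map ((!) es) js" and ?E' = "(\<lambda>j. set (es ! j)) ` I"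
  have len: "length js = p" using distinct_card[OF js(2)] js(1) I(2) by simp
  have "encodes_edges (set (map set ?es')) (length ?es' # concat (map encode ?es'))"
  proof (rule encodes_edgesI)
    show "\<forall>xs\<in>set ?es'. distinct xs" using dist(2) js(1) I(1) by auto
    show "distinct (map set ?es')"
      using js inj_on_subset[OF inj I(1)] by (simp add: distinct_map o_def)
  qed
  moreover have "set (map set ?es') = ?E'" using js(1) by auto
  moreover have "result s = length ?es' # concat (map encode ?es')"
    unfolding res js_def[symmetric] using len by simp
  ultimately have "encodes_edges ?E' (result s)" by simp
  moreover have "computes program ws t (result s)" using t(1) by (auto simp: computes_def)
  moreover have "?E' \<subseteq> E" using I(1) by (auto simp: E)
  moreover have "card ?E' = p" using card_image[OF inj_on_subset[OF inj I(1)]] I(2) by simp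
  moreover have "real (card (\<Union>?E')) \<le> 10 * sqrt (real (card E)) * real (min_union E p)"
  proof -
    \<comment> \<open>Relaxing the square root of \<open>2 m\<close> to twice that of
      \<open>m\<close> turns the factor 5 into 10.\<close>
    have "real r * real r \<le> 2 * real ?m" using r by (metis of_nat_le_iff of_nat_mult of_nat_numeral)
    also have "\<dots> \<le> (2 * sqrt (real ?m)) * (2 * sqrt (real ?m))" by simp
    finally have "(real r)\<^sup>2 \<le> (2 * sqrt (real ?m))\<^sup>2"
      by (simp only: power2_eq_square)
    then have "real r \<le> 2 * sqrt (real ?m)" by (rule power2_le_imp_le) simp
    then have "5 * real r * real (min_union E p) \<le> 10 * sqrt (real ?m) * real (min_union E p)"
      by (intro mult_right_mono) auto
    moreover have "real (card (verts es I)) \<le> 5 * real r * real (min_union E p)"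
      using small by (metis of_nat_le_iff of_nat_mult of_nat_numeral)
    ultimately have "real (card (verts es I)) \<le> 10 * sqrt (real ?m) * real (min_union E p)"
      by (rule order_trans[rotated])
    then show ?thesis by (simp add: cE verts_def)
  qed
  ultimately show "\<exists>t ws' E'. computes program ws t ws' \<and> t \<le> poly time_poly ?x \<and>
      encodes_edges E' ws' \<and> E' \<subseteq> E \<and> card E' = p \<and>
      real (card (\<Union>E')) \<le> 10 * sqrt (real (card E)) * real (min_union E p)"
    using t(2) by blast
qed

end
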